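(* Let $\Gamma$ be a countable group and $\Gamma\curvearrowright\mu\Gamma$ its universal minimal flow. Then the clopen type semigroup $T(\Gamma\curvearrowright\mu\Gamma)$ is unperforated and the relation $\le$ is a partial order on it. In particular, the action $\Gamma\curvearrowright\mu\Gamma$ has dynamical comparison.
   Context: The universal minimal flow $\mu\Gamma$ is the (unique up to isomorphism) minimal compact Hausdorff $\Gamma$-flow which factors onto every minimal compact Hausdorff $\Gamma$-flow; it is a compact, Hausdorff, $0$-dimensional space (isomorphic to any minimal subflow of $\beta\Gamma$). Clopen type semigroup of an action $\alpha\colon\Gamma\curvearrowright X$ ($X$ compact Hausdorff $0$-dimensional): let $Y = X\times\mathbb N$, and let $\tilde\Gamma=\Gamma\times\mathfrak S$ ($\mathfrak S$ the permutation group of $\mathbb N$) act on $Y$ by $(\gamma,\sigma)(x,n)=(\alpha(\gamma)x,\sigma(n))$. A clopen $A\subseteq Y$ is bounded if $A\cap(X\times\{n\})=\emptyset$ for all large $n$. Bounded clopen $A,B$ are equidecomposable if there are clopen $A_1,\dots,A_n$ and $\tilde\gamma_i\in\tilde\Gamma$ with $A=\bigsqcup_i A_i$, $B=\bigsqcup_i\tilde\gamma_iA_i$. $T(\alpha)$ is the set of classes $[A]$, with $[A]+[B]=[A'\sqcup B']$ for disjoint representatives; $0=[\emptyset]$. $a\le b$ iff $b=a+c$ for some $c$. Unperforated: $na\le nb\Rightarrow a\le b$ for all $n\ge1$. Dynamical comparison: for all nonempty clopen $A,B\subseteq X$ with $\mu(A)<\mu(B)$ for every $\alpha$-invariant Radon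 probability measure $\mu$ on $X$, one has $[A\times\{0\}]\le[B\times\{0\}]$. *)

theory Defs
  imports "HOL-Analysis.Analysis" "HOL-Probability.Probability" "HOL-Library.Countable"
begin

text \<open>An action of the group 'g (written additively, not necessarily commutative)
on the topological space X is a map alpha :: 'g => 'x => 'x; only its values on
topspace X matter.  Y = X x N with N discrete; the group tilde-Gamma = Gamma x Sym(N)
acts by (g, s)(x, n) = (alpha g x, s n).\<close>

definition Ytop :: "'x topology \<Rightarrow> ('x \<times> nat) topology" where
  "Ytop X = prod_topology X (discrete_topology (UNIV :: nat set))"

definition bounded_clopen :: "'x topology \<Rightarrow> ('x \<times> nat) set \<Rightarrow> bool" where
  "bounded_clopen X A \<longleftrightarrow> closedin (Ytop X) A \<and> openin (Ytop X) A \<and>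
     (\<exists>N. \<forall>x n. (x, n) \<in> A \<longrightarrow> n < N)"

definition tact :: "('g \<Rightarrow> 'x \<Rightarrow> 'x) \<Rightarrow> 'g \<Rightarrow> (nat \<Rightarrow> nat) \<Rightarrow> ('x \<times> nat) \<Rightarrow> ('x \<times> nat)" where
  "tact alpha g s = (\<lambda>(x, n). (alpha g x, s n))"

definition equidec :: "'x topology \<Rightarrow> ('g \<Rightarrow> 'x \<Rightarrow> 'x) \<Rightarrow> ('x \<times> nat) set \<Rightarrow> ('x \<times> nat) set \<Rightarrow> bool" where
  "equidec X alpha A B \<longleftrightarrow> bounded_clopen X A \<and> bounded_clopen X B \<and>
     (\<exists>(n::nat) (P :: nat \<Rightarrow> ('x \<times> nat) set) (g :: nat \<Rightarrow> 'g) (s :: nat \<Rightarrow> nat \<Rightarrow> nat).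
        (\<forall>i<n. closedin (Ytop X) (P i) \<and> openin (Ytop X) (P i) \<and> bij (s i)) \<and>
        A = (\<Union>i<n. P i) \<and> (\<forall>i<n. \<forall>j<n. i \<noteq> j \<longrightarrow> P i \<inter> P j = {}) \<and>
        B = (\<Union>i<n. tact alpha (g i) (s i) ` P i) \<and>
        (\<forall>i<n. \<forall>j<n. i \<noteq> j \<longrightarrow> tact alpha (g i) (s i) ` P i \<inter> tact alpha (g j) (s j) ` P j = {}))"

definition tclass :: "'x topology \<Rightarrow> ('g \<Rightarrow> 'x \<Rightarrow> 'x) \<Rightarrow> ('x \<times> nat) set \<Rightarrow> ('x \<times> nat) set set" where
  "tclass X alpha A = {B. equidec X alpha A B}"

definition type_semigroup :: "'x topology \<Rightarrow> ('g \<Rightarrow> 'x \<Rightarrow> 'x) \<Rightarrow> ('x \<times> nat) set set set" where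
  "type_semigroup X alpha = {tclass X alpha A | A. bounded_clopen X A}"

definition tzero :: "'x topology \<Rightarrow> ('g \<Rightarrow> 'x \<Rightarrow> 'x) \<Rightarrow> ('x \<times> nat) set set" where
  "tzero X alpha = tclass X alpha {}"

definition tadd :: "'x topology \<Rightarrow> ('g \<Rightarrow> 'x \<Rightarrow> 'x) \<Rightarrow> ('x \<times> nat) set set \<Rightarrow> ('x \<times> nat) set set \<Rightarrow> ('x \<times> nat) set set" where
  "tadd X alpha a b = (SOME c. \<exists>A B. A \<in> a \<and> B \<in> b \<and> A \<inter> B = {} \<and> c = tclass X alpha (A \<union> B))"

definition tle :: "'x topology \<Rightarrow> ('g \<Rightarrow> 'x \<Rightarrow> 'x) \<Rightarrow> ('x \<times> nat) set set \<Rightarrow> ('x \<times> nat) set set \<Rightarrow> bool" where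
  "tle X alpha a b \<longleftrightarrow> (\<exists>c \<in> type_semigroup X alpha. b = tadd X alpha a c)"

fun tmul :: "'x topology \<Rightarrow> ('g \<Rightarrow> 'x \<Rightarrow> 'x) \<Rightarrow> nat \<Rightarrow> ('x \<times> nat) set set \<Rightarrow> ('x \<times> nat) set set" where
  "tmul X alpha 0 a = tzero X alpha"
| "tmul X alpha (Suc n) a = tadd X alpha a (tmul X alpha n a)"

definition unperforated :: "'x topology \<Rightarrow> ('g \<Rightarrow> 'x \<Rightarrow> 'x) \<Rightarrow> bool" where
  "unperforated X alpha \<longleftrightarrow>
     (\<forall>a \<in> type_semigroup X alpha. \<forall>b \<in> type_semigroup X alpha. \<forall>n::nat. n \<ge> 1 \<longrightarrow>
        tle X alpha (tmul X alpha n a) (tmul X alpha n b) \<longrightarrow> tle X alpha a b)"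

definition tle_rel :: "'x topology \<Rightarrow> ('g \<Rightarrow> 'x \<Rightarrow> 'x) \<Rightarrow> (('x \<times> nat) set set) rel" where
  "tle_rel X alpha = {(a, b). a \<in> type_semigroup X alpha \<and> b \<in> type_semigroup X alpha \<and> tle X alpha a b}"

definition borel_sets_of :: "'x topology \<Rightarrow> 'x set set" where
  "borel_sets_of X = sigma_sets (topspace X) {U. openin X U}"

definition radon_prob :: "'x topology \<Rightarrow> 'x measure \<Rightarrow> bool" where
  "radon_prob X M \<longleftrightarrow> prob_space M \<and> space M = topspace X \<and> sets M = borel_sets_of X \<and>
     (\<forall>B \<in> sets M. measure M B = Inf {measure M U | U. openin X U \<and> B \<subseteq> U}) \<and>
     (\<forall>U. openin X U \<longrightarrow> measure M U = Sup {measure M K | K. compactin X K \<and> K \<subseteq> U})"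

definition invariant_measure :: "'x topology \<Rightarrow> ('g \<Rightarrow> 'x \<Rightarrow> 'x) \<Rightarrow> 'x measure \<Rightarrow> bool" where
  "invariant_measure X alpha M \<longleftrightarrow>
     (\<forall>g. \<forall>B \<in> sets M. measure M ((alpha g -` B) \<inter> topspace X) = measure M B)"

definition dynamical_comparison :: "'x topology \<Rightarrow> ('g \<Rightarrow> 'x \<Rightarrow> 'x) \<Rightarrow> bool" where
  "dynamical_comparison X alpha \<longleftrightarrow>
     (\<forall>A B. closedin X A \<and> openin X A \<and> A \<noteq> {} \<and> closedin X B \<and> openin X B \<and> B \<noteq> {} \<and>
        (\<forall>M. radon_prob X M \<and> invariant_measure X alpha M \<longrightarrow> measure M A < measure M B) \<longrightarrow>
        tle X alpha (tclass X alpha (A \<times> {0})) (tclass X alpha (B \<times> {0})))"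

section \<open>The universal minimal flow as a minimal subflow of beta Gamma\<close>

definition ultrafilters :: "'g set set set" where
  "ultrafilters = {U. UNIV \<in> U \<and> {} \<notin> U \<and> (\<forall>A B. A \<in> U \<longrightarrow> B \<in> U \<longrightarrow> A \<inter> B \<in> U) \<and>
      (\<forall>A B. A \<in> U \<longrightarrow> A \<subseteq> B \<longrightarrow> B \<in> U) \<and> (\<forall>A. A \<in> U \<or> - A \<in> U)}"

definition beta_top :: "('g set set) topology" where
  "beta_top = topology_generated_by {{p \<in> ultrafilters. S \<in> p} | S. True}"

definition beta_act :: "'g::group_add \<Rightarrow> 'g set set \<Rightarrow> 'g set set" where
  "beta_act g p = {(\<lambda>x. g + x) ` S | S. S \<in> p}"

definition minimal_subflow :: "('g::group_add) set set set \<Rightarrow> bool" where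
  "minimal_subflow M \<longleftrightarrow> M \<noteq> {} \<and> closedin beta_top M \<and> (\<forall>g. beta_act g ` M \<subseteq> M) \<and>
     (\<forall>N. N \<subseteq> M \<and> N \<noteq> {} \<and> closedin beta_top N \<and> (\<forall>g. beta_act g ` N \<subseteq> N) \<longrightarrow> N = M)"

end

theory Submission
  imports Defs
begin

text \<open>
  Let \<open>p\<close> be an idempotent of the left ideal \<open>M\<close> of \<open>\<beta>\<Gamma>\<close>. It is a right identity of \<open>M\<close>, so
  \<open>q \<mapsto> q p\<close> is an equivariant retraction of \<open>\<beta>\<Gamma>\<close> onto \<open>M\<close>. Hence \<open>T(M)\<close> is an ordered retract of
  the type semigroup of \<open>\<Gamma>\<close> acting on all of its subsets: a clopen set is compared through the set
  of times at which the orbit of \<open>p\<close> visits it. On sets of group elements, unperforation is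
  Hall's marriage theorem and antisymmetry is the Schroeder--Bernstein argument.

  For comparison, if \<open>[A] \<le> [B]\<close> fails, then Hall's condition is violated for the visiting
  times of \<open>A\<close> and \<open>B\<close> at every finite scale. Since \<open>B\<close> is visited syndetically, the violating finite
  sets grow slowly and yield almost invariant sets meeting the times of \<open>A\<close> at least as often as
  those of \<open>B\<close>. A limit mean gives an invariant content on the clopen sets, which
  extends to a Radon measure \<open>\<mu>\<close> with \<open>\<mu>(B) \<le> \<mu>(A)\<close>.
\<close>

section \<open>Hall's marriage theorem and piecewise translations\<close>

text \<open>In a general zero-dimensional flow, a matching between orbit points has no reason to be
  clopen. Here every subset of the group, however it was chosen, determines a clopen subset of
  \<open>M\<close>, so Hall and Schroeder-Bernstein may pick their pieces freely; only the
  finiteness of the number of pieces has to survive the transfer. That is why all comparison maps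
  move points by finitely many group elements, and why Hall's theorem is applied to graphs whose
  edges have displacement in one fixed finite set. The right identity makes the transfer lossless:
  \<open>umult q p = q\<close> says that \<open>q\<close> sees the visiting times of a clopen set
  exactly as it sees the set itself. Amenability is never assumed. The almost invariant sets come
  out of the failure of Hall's condition alone, so if there is no invariant measure, that failure
  cannot occur and any two nonempty clopen sets are below each other.\<close>

lemma minimal_element_Inter:
  assumes "\<A> \<noteq> {}"
    and Int: "\<And>\<C>. \<C> \<noteq> {} \<Longrightarrow> subset.chain \<A> \<C> \<Longrightarrow> \<Inter>\<C> \<in> \<A>"
  obtains m where "m \<in> \<A>" "\<And>x. x \<in> \<A> \<Longrightarrow> x \<subseteq> m \<Longrightarrow> x = m"
proof -
  \<comment> \<open>Complementation turns intersections of chains into unions, the form in which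
    Zorn's lemma is applied.\<close>
  have "\<exists>M\<in>uminus ` \<A>. \<forall>X\<in>uminus ` \<A>. M \<subseteq> X \<longrightarrow> X = M"
  proof (rule subset_Zorn_nonempty)
    show "uminus ` \<A> \<noteq> {}"
      using assms(1) by simp
    fix \<C> assume C: "\<C> \<noteq> {}" "subset.chain (uminus ` \<A>) \<C>"
    have *: "uminus ` \<C> \<subseteq> \<A>"
      using C(2) by (force simp: subset_chain_def)
    have "subset.chain \<A> (uminus ` \<C>)"
      unfolding subset_chain_def
    proof (intro conjI ballI *)
      fix X Y assume "X \<in> uminus ` \<C>" "Y \<in> uminus ` \<C>"
      then obtain X' Y' where "X = - X'" "Y = - Y'" "X' \<in> \<C>" "Y' \<in> \<C>" by blast
      then show "X \<subseteq> Y \<or> Y \<subseteq> X"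
        using C(2) unfolding subset_chain_def by (metis Compl_subset_Compl_iff)
    qed
    with Int[of "uminus ` \<C>"] C(1) have "\<Inter>(uminus ` \<C>) \<in> \<A>" by simp
    moreover have "\<Union>\<C> = - \<Inter>(uminus ` \<C>)" by auto
    ultimately show "\<Union>\<C> \<in> uminus ` \<A>" by (metis imageI)
  qed
  then show thesis
    using that by (force simp: Compl_eq_Compl_iff)
qed

text \<open>Rado's proof, for possibly infinite \<open>X\<close>: a minimal subrelation that still
  satisfies Hall's condition is the graph of an injection. Zorn's lemma applies because fibres are
  finite: over each finite \<open>F\<close>, a member of the chain with fewest edges already agrees
  with the intersection of the chain.\<close>

lemma hall_matching:
  fixes E :: "('a \<times> 'b) set"
  assumes fin: "\<And>x. x \<in> X \<Longrightarrow> finite (E `` {x})"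
    and hall: "\<And>F. finite F \<Longrightarrow> F \<subseteq> X \<Longrightarrow> card F \<le> card (E `` F)"
  obtains f where "inj_on f X" "\<And>x. x \<in> X \<Longrightarrow> (x, f x) \<in> E"
proof -
  define \<A> where "\<A> = {D. D \<subseteq> E \<and> (\<forall>F. finite F \<and> F \<subseteq> X \<longrightarrow> card F \<le> card (D `` F))}"
  have finE: "finite (D `` F)" if "D \<subseteq> E" "finite F" "F \<subseteq> X" for D F
  proof -
    have "D `` F \<subseteq> (\<Union>x\<in>F. E `` {x})" using that by auto
    moreover have "finite (\<Union>x\<in>F. E `` {x})" using that fin by auto
    ultimately show ?thesis by (rule finite_subset)
  qed
  obtain D where D: "D \<in> \<A>" and min: "\<And>D'. D' \<in> \<A> \<Longrightarrow> D' \<subseteq> D \<Longrightarrow> D' = D"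
  proof (rule minimal_element_Inter[of \<A>])
    show "\<A> \<noteq> {}" using hall by (auto simp: \<A>_def)
    fix \<C> assume C: "\<C> \<noteq> {}" "subset.chain \<A> \<C>"
    have "card F \<le> card (\<Inter>\<C> `` F)" if F: "finite F" "F \<subseteq> X" for F
    proof -
      have finr: "finite (D \<inter> F \<times> UNIV)" if "D \<in> \<C>" for D
      proof -
        have "D \<subseteq> E" using C that by (auto simp: subset_chain_def \<A>_def)
        then have "D \<inter> F \<times> UNIV \<subseteq> F \<times> (D `` F)" by auto
        then show ?thesis using finE[OF \<open>D \<subseteq> E\<close> F] F(1) by (meson finite_SigmaI finite_subset)
      qed
      obtain D where D: "D \<in> \<C>" "\<And>D'. D' \<in> \<C> \<Longrightarrow> card (D \<inter> F \<times> UNIV) \<le> card (D' \<inter> F \<times> UNIV)"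
        using ex_has_least_nat[of "\<lambda>D. D \<in> \<C>" _ "\<lambda>D. card (D \<inter> F \<times> UNIV)"] C(1) by blast
      have "D \<inter> F \<times> UNIV \<subseteq> D'" if D': "D' \<in> \<C>" for D'
      proof (cases "D \<subseteq> D'")
        case False
        then have "D' \<subseteq> D" using C(2) D(1) D' by (auto simp: subset_chain_def)
        then have "D' \<inter> F \<times> UNIV = D \<inter> F \<times> UNIV"
          by (intro card_seteq finr D D') auto
        then show ?thesis by auto
      qed auto
      then have "D `` F \<subseteq> \<Inter>\<C> `` F" by blast
      then have "D `` F = \<Inter>\<C> `` F" using D(1) by blast
      moreover have "card F \<le> card (D `` F)"
        using D(1) C(2) F by (auto simp: subset_chain_def \<A>_def)
      ultimately show ?thesis by simp
    qed
    then show "\<Inter>\<C> \<in> \<A>" using C by (auto simp: subset_chain_def \<A>_def)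
  qed auto
  have DE: "D \<subseteq> E" and hallD: "\<And>F. finite F \<Longrightarrow> F \<subseteq> X \<Longrightarrow> card F \<le> card (D `` F)"
    using D by (auto simp: \<A>_def)
  text \<open>An edge whose removal destroys Hall's condition leaves a tight set behind.\<close>
  have tight: "\<exists>F. finite F \<and> F \<subseteq> X \<and> x \<notin> F \<and> card ((D `` {x} - {y}) \<union> D `` F) \<le> card F"
    if xy: "(x, y) \<in> D" "x \<in> X" for x y
  proof -
    have "D - {(x, y)} \<notin> \<A>" using min[of "D - {(x, y)}"] xy by auto
    then obtain F where F: "finite F" "F \<subseteq> X" "card ((D - {(x, y)}) `` F) < card F"
      using DE by (auto simp: \<A>_def not_le)
    have "x \<in> F"
    proof (rule ccontr)
      assume "x \<notin> F"
      then have "(D - {(x, y)}) `` F = D `` F" by auto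
      with hallD[OF F(1,2)] F(3) show False by simp
    qed
    then have "(D `` {x} - {y}) \<union> D `` (F - {x}) = (D - {(x, y)}) `` F" by auto
    moreover have "card F = Suc (card (F - {x}))"
      using \<open>x \<in> F\<close> F(1) by (rule card.remove[rotated])
    ultimately have "card ((D `` {x} - {y}) \<union> D `` (F - {x})) \<le> card (F - {x})"
      using F(3) by (simp only: less_Suc_eq_le)
    moreover have "finite (F - {x})" "F - {x} \<subseteq> X" "x \<notin> F - {x}" using F(1,2) by auto
    ultimately show ?thesis by meson
  qed
  \<comment> \<open>Two edges at \<open>x\<close> would give two tight sets \<open>F\<close> and
    \<open>G\<close>. Adding Hall's inequalities for \<open>insert x (F \<union> G)\<close> and
    \<open>F \<inter> G\<close> and comparing with the two tight sets leaves a surplus of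
    one.\<close>
  have uniq: "y = z" if xyz: "(x, y) \<in> D" "(x, z) \<in> D" "x \<in> X" for x y z
  proof (rule ccontr)
    assume "y \<noteq> z"
    obtain F where F: "finite F" "F \<subseteq> X" "x \<notin> F" "card ((D `` {x} - {y}) \<union> D `` F) \<le> card F"
      using tight[OF xyz(1,3)] by blast
    obtain G where G: "finite G" "G \<subseteq> X" "x \<notin> G" "card ((D `` {x} - {z}) \<union> D `` G) \<le> card G"
      using tight[OF xyz(2,3)] by blast
    let ?P = "(D `` {x} - {y}) \<union> D `` F" and ?Q = "(D `` {x} - {z}) \<union> D `` G"
    have finPQ: "finite ?P" "finite ?Q"
      using finE[OF DE, of "{x}"] finE[OF DE F(1,2)] finE[OF DE G(1,2)] xyz(3) by simp_all
    have "Suc (card (F \<union> G)) = card (insert x (F \<union> G))" using F(1,3) G(1,3) by simp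
    also have "\<dots> \<le> card (D `` insert x (F \<union> G))" using F(1,2) G(1,2) xyz(3) by (intro hallD) auto
    \<comment> \<open>No neighbour of \<open>x\<close> is lost: \<open>y\<close> is deleted on one
      side only, and \<open>z\<close> on the other.\<close>
    also have "D `` insert x (F \<union> G) = ?P \<union> ?Q" using \<open>y \<noteq> z\<close> by blast
    finally have 1: "Suc (card (F \<union> G)) \<le> card (?P \<union> ?Q)" .
    have "card (F \<inter> G) \<le> card (D `` (F \<inter> G))" using F(1,2) G(1,2) by (intro hallD) auto
    also have "\<dots> \<le> card (?P \<inter> ?Q)" using finPQ by (intro card_mono) auto
    finally have 2: "card (F \<inter> G) \<le> card (?P \<inter> ?Q)" .
    have "card ?P + card ?Q = card (?P \<union> ?Q) + card (?P \<inter> ?Q)"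
      using finPQ by (rule card_Un_Int)
    moreover have "card F + card G = card (F \<union> G) + card (F \<inter> G)"
      using F(1) G(1) by (rule card_Un_Int)
    ultimately show False using 1 2 F(4) G(4) by linarith
  qed
  have ex: "\<exists>y. (x, y) \<in> D" if "x \<in> X" for x
  proof -
    have "card {x} \<le> card (D `` {x})" using that by (intro hallD) auto
    then have "D `` {x} \<noteq> {}" by auto
    then show ?thesis by auto
  qed
  then obtain f where f: "\<And>x. x \<in> X \<Longrightarrow> (x, f x) \<in> D" by metis
  have "inj_on f X"
  proof (rule inj_onI, rule ccontr)
    fix x x' assume x: "x \<in> X" "x' \<in> X" "f x = f x'" "x \<noteq> x'"
    have "card {x, x'} \<le> card (D `` {x, x'})" using x by (intro hallD) auto
    moreover have "D `` {x, x'} \<subseteq> {f x}" using f uniq x by auto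
    then have "card (D `` {x, x'}) \<le> 1" using card_mono[of "{f x}"] by auto
    ultimately show False using x(4) by simp
  qed
  then show thesis using that f DE by blast
qed

section \<open>Piecewise translations between sets of group elements\<close>

definition displacement :: "('g::group_add \<times> 'b \<Rightarrow> 'g \<times> 'c) \<Rightarrow> 'g \<times> 'b \<Rightarrow> 'g" where
  "displacement f s = fst (f s) - fst s"

text \<open>A finite set of displacements means that the map is a translation on each of finitely many pieces.\<close>
definition teq :: "('g::group_add \<times> 'b) set \<Rightarrow> ('g \<times> 'c) set \<Rightarrow> bool" where
  "teq S T \<longleftrightarrow> (\<exists>f. bij_betw f S T \<and> finite (displacement f ` S))"

definition tinj :: "('g::group_add \<times> 'b) set \<Rightarrow> ('g \<times> 'c) set \<Rightarrow> bool" where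
  "tinj S T \<longleftrightarrow> (\<exists>f. inj_on f S \<and> f ` S \<subseteq> T \<and> finite (displacement f ` S))"

lemma tinj_iff_teq: "tinj S T \<longleftrightarrow> (\<exists>T'\<subseteq>T. teq S T')"
  unfolding tinj_def teq_def bij_betw_def by blast

lemma teq_imp_tinj: "teq S T \<Longrightarrow> tinj S T"
  by (auto simp: tinj_iff_teq)

lemma teq_refl: "teq S S"
  unfolding teq_def
  by (rule exI[of _ id]) (auto simp: displacement_def intro: finite_subset[of _ "{0}"])

text \<open>With the difference taken on the right, a map acts at \<open>s\<close> as left
  translation by its displacement there; the summands appear in the order in which left translations
  compose.\<close>

lemma displacement_comp: "displacement (g \<circ> f) s = displacement g (f s) + displacement f s"
  by (simp add: displacement_def add_diff_eq)

lemma finite_displacement_comp: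
  assumes "finite (displacement f ` S)" "finite (displacement g ` T)" "f ` S \<subseteq> T"
  shows "finite (displacement (g \<circ> f) ` S)"
proof (rule finite_subset)
  show "displacement (g \<circ> f) ` S \<subseteq> (\<lambda>(a, b). a + b) ` (displacement g ` T \<times> displacement f ` S)"
    using assms(3) by (force simp: displacement_comp)
qed (use assms in auto)

lemma teq_trans:
  assumes "teq S T" "teq T U"
  shows "teq S U"
proof -
  obtain f g where "bij_betw f S T" "finite (displacement f ` S)"
      "bij_betw g T U" "finite (displacement g ` T)"
    using assms unfolding teq_def by blast
  then show ?thesis
    unfolding teq_def
    by (intro exI[of _ "g \<circ> f"] conjI bij_betw_trans finite_displacement_comp) (auto simp: bij_betw_def)
qed

lemma teq_sym:
  assumes "teq S T"
  shows "teq T S"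
proof -
  obtain f where f: "bij_betw f S T" "finite (displacement f ` S)"
    using assms unfolding teq_def by blast
  define g where "g = inv_into S f"
  have "displacement g ` T \<subseteq> uminus ` (displacement f ` S)"
  proof safe
    fix a b assume "(a, b) \<in> T"
    then have "g (a, b) \<in> S" "f (g (a, b)) = (a, b)"
      using f(1) by (auto simp: g_def bij_betw_def inv_into_into f_inv_into_f)
    then have "displacement g (a, b) = - displacement f (g (a, b))"
      by (simp add: displacement_def)
    with \<open>g (a, b) \<in> S\<close> show "displacement g (a, b) \<in> uminus ` displacement f ` S" by blast
  qed
  then have "finite (displacement g ` T)" using f(2) by (meson finite_imageI finite_subset)
  then show ?thesis
    unfolding teq_def using bij_betw_inv_into[OF f(1)] g_def by blast
qed

lemma tinj_trans:
  assumes "tinj S T" "tinj T U"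
  shows "tinj S U"
proof -
  obtain f g where fg: "inj_on f S" "f ` S \<subseteq> T" "finite (displacement f ` S)"
      "inj_on g T" "g ` T \<subseteq> U" "finite (displacement g ` T)"
    using assms unfolding tinj_def by blast
  have "inj_on (g \<circ> f) S" using fg by (metis comp_inj_on inj_on_subset)
  moreover have "(g \<circ> f) ` S \<subseteq> U" using fg by auto
  ultimately show ?thesis
    unfolding tinj_def using finite_displacement_comp[OF fg(3,6,2)] by blast
qed

lemma teq_Un:
  assumes "teq S T" "teq S' T'" "S \<inter> S' = {}" "T \<inter> T' = {}"
  shows "teq (S \<union> S') (T \<union> T')"
proof -
  obtain f f' where f: "bij_betw f S T" "finite (displacement f ` S)"
      "bij_betw f' S' T'" "finite (displacement f' ` S')"
    using assms unfolding teq_def by blast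
  define h where "h s = (if s \<in> S then f s else f' s)" for s
  have "bij_betw h S T" using f(1) by (subst bij_betw_cong[of _ _ f]) (auto simp: h_def)
  moreover have "bij_betw h S' T'"
    using f(3) assms(3) by (subst bij_betw_cong[of _ _ f']) (auto simp: h_def)
  ultimately have "bij_betw h (S \<union> S') (T \<union> T')"
    using assms by (intro bij_betw_combine) auto
  moreover have "displacement h ` (S \<union> S') \<subseteq> displacement f ` S \<union> displacement f' ` S'"
  proof
    fix d assume "d \<in> displacement h ` (S \<union> S')"
    then obtain s where s: "s \<in> S \<union> S'" "d = displacement h s" by blast
    then show "d \<in> displacement f ` S \<union> displacement f' ` S'"
      by (cases "s \<in> S") (auto simp: displacement_def h_def)
  qed
  ultimately show ?thesis
    unfolding teq_def using f by (meson finite_UnI finite_subset)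
qed

text \<open>Banach's decomposition: on a suitable part of \<open>S\<close> one injection is used, on the rest
  the inverse of the other one.\<close>
lemma tinj_antisym:
  assumes "tinj S T" "tinj T S"
  shows "teq S T"
proof -
  obtain f where f: "inj_on f S" "f ` S \<subseteq> T" "finite (displacement f ` S)"
    using assms unfolding tinj_def by blast
  obtain g where g: "inj_on g T" "g ` T \<subseteq> S" "finite (displacement g ` T)"
    using assms unfolding tinj_def by blast
  \<comment> \<open>\<open>X\<close> occurs under two complements, so the operator is monotone. At a
    fixed point, \<open>S - X\<close> is exactly the image under \<open>g\<close> of what
    \<open>f\<close> leaves uncovered in \<open>T\<close>.\<close>
  define X where "X = lfp (\<lambda>X. S - g ` (T - f ` X))"
  have X: "X = S - g ` (T - f ` X)"
    unfolding X_def by (rule lfp_unfold) (auto simp: mono_def)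
  have "teq X (f ` X)"
    unfolding teq_def using f X by (metis Diff_subset bij_betw_def finite_subset image_mono inj_on_subset)
  moreover have "teq (T - f ` X) (g ` (T - f ` X))"
    unfolding teq_def using g by (metis Diff_subset bij_betw_def finite_subset image_mono inj_on_subset)
  then have "teq (g ` (T - f ` X)) (T - f ` X)" by (rule teq_sym)
  ultimately have "teq (X \<union> g ` (T - f ` X)) (f ` X \<union> (T - f ` X))"
    by (rule teq_Un) (use X in blast)+
  moreover have "X \<union> g ` (T - f ` X) = S" using X g(2) by blast
  moreover have "f ` X \<union> (T - f ` X) = T" using X f(2) by blast
  ultimately show ?thesis by simp
qed

text \<open>The copy index is stored beside the level, over the same group element, so passing
  between copies costs no displacement.\<close>

definition copies :: "nat \<Rightarrow> ('g \<times> 'b) set \<Rightarrow> ('g \<times> 'b \<times> nat) set" where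
  "copies n S = {(x, k, i). (x, k) \<in> S \<and> i < n}"

lemma teq_copies_Suc:
  assumes "teq S S'" "teq D' (copies n S)" "S' \<inter> D' = {}"
  shows "teq (S' \<union> D') (copies (Suc n) S)"
proof -
  let ?f = "\<lambda>(x, k). (x, k, n)"
  have "bij_betw ?f S (?f ` S)" by (auto intro!: bij_betw_imageI inj_onI)
  moreover have "displacement ?f ` S \<subseteq> {0}" by (auto simp: displacement_def)
  ultimately have "teq S (?f ` S)"
    unfolding teq_def by (meson finite.emptyI finite.insertI finite_subset)
  then have "teq S' (?f ` S)" using assms(1) teq_sym teq_trans by blast
  then have "teq (S' \<union> D') (?f ` S \<union> copies n S)"
    using assms by (intro teq_Un) (auto simp: copies_def)
  also have "?f ` S \<union> copies n S = copies (Suc n) S"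
    by (auto simp: copies_def less_Suc_eq intro: rev_image_eqI)
  finally show ?thesis .
qed

text \<open>Edges join points whose displacement lies in the finite set \<open>K\<close>. This
  bounds the degrees, given finite fibres of \<open>T\<close>, and any matching automatically has
  finitely many displacements.\<close>

lemma tinj_if_hall:
  fixes S :: "('g::group_add \<times> 'b) set" and T :: "('g \<times> 'c) set"
  assumes "finite K" and fin: "\<And>x. finite {k. (x, k) \<in> T}"
    and hall: "\<And>F. finite F \<Longrightarrow> F \<subseteq> S \<Longrightarrow> card F \<le> card {t\<in>T. \<exists>s\<in>F. fst t - fst s \<in> K}"
  shows "tinj S T"
proof -
  define E :: "(('g \<times> 'b) \<times> ('g \<times> 'c)) set" where "E = {(s, t). t \<in> T \<and> fst t - fst s \<in> K}"
  obtain f where f: "inj_on f S" "\<And>x. x \<in> S \<Longrightarrow> (x, f x) \<in> E"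
  proof (rule hall_matching[of S E])
    fix s :: "'g \<times> 'b"
    have "E `` {s} \<subseteq> (\<Union>k\<in>K. {k + fst s} \<times> {l. (k + fst s, l) \<in> T})"
    proof
      fix t assume "t \<in> E `` {s}"
      then have t: "t \<in> T" "fst t - fst s \<in> K" by (auto simp: E_def)
      show "t \<in> (\<Union>k\<in>K. {k + fst s} \<times> {l. (k + fst s, l) \<in> T})"
        by (rule UN_I[OF t(2)]) (use t(1) in \<open>auto simp: mem_Times_iff\<close>)
    qed
    then show "finite (E `` {s})"
      by (rule finite_subset) (use assms in auto)
  next
    fix F assume F: "finite F" "F \<subseteq> S"
    have "E `` F = {t\<in>T. \<exists>s\<in>F. fst t - fst s \<in> K}" by (auto simp: E_def)
    with hall[OF F] show "card F \<le> card (E `` F)" by simp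
  qed (use that in blast)
  have "f ` S \<subseteq> T" "displacement f ` S \<subseteq> K"
    using f(2) by (auto simp: E_def displacement_def)
  then show ?thesis
    unfolding tinj_def using f(1) \<open>finite K\<close> finite_subset by blast
qed

lemma finite_translates:
  assumes "finite K" and fin: "\<And>x. finite {k. (x, k) \<in> T}" and "finite F"
  shows "finite {t\<in>T. \<exists>s\<in>F. fst t - fst s \<in> (K :: 'g::group_add set)}"
proof (rule finite_subset)
  show "{t\<in>T. \<exists>s\<in>F. fst t - fst s \<in> K} \<subseteq> (\<Union>s\<in>F. \<Union>k\<in>K. {k + fst s} \<times> {l. (k + fst s, l) \<in> T})"
  proof safe
    fix a b x y assume t: "(a, b) \<in> T" "(x, y) \<in> F" "fst (a, b) - fst (x, y) \<in> K"
    show "(a, b) \<in> (\<Union>s\<in>F. \<Union>k\<in>K. {k + fst s} \<times> {l. (k + fst s, l) \<in> T})"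
      by (rule UN_I[OF t(2)], rule UN_I[OF t(3)]) (use t in auto)
  qed
qed (use assms in auto)

text \<open>Let \<open>K\<close> be the displacement set of the given injection. It carries the
  \<open>n\<close> copies of a finite \<open>F\<close> into the \<open>n\<close> copies of the
  \<open>K\<close>-neighbourhood of \<open>F\<close> in \<open>T\<close>; dividing the resulting
  inequality of cardinalities by \<open>n\<close> is Hall's condition for \<open>S\<close> and
  \<open>T\<close>.\<close>

lemma tinj_copies_cancel:
  fixes S :: "('g::group_add \<times> 'b) set" and T :: "('g \<times> 'c) set"
  assumes "tinj (copies n S) (copies n T)" "n \<ge> 1" and fin: "\<And>x. finite {k. (x, k) \<in> T}"
  shows "tinj S T"
proof -
  obtain f where f: "inj_on f (copies n S)" "f ` copies n S \<subseteq> copies n T"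
      "finite (displacement f ` copies n S)"
    using assms(1) unfolding tinj_def by blast
  define K where "K = displacement f ` copies n S"
  show ?thesis
  proof (rule tinj_if_hall[OF _ fin, of K])
    show "finite K" using f(3) by (simp add: K_def)
    fix F assume F: "finite F" "F \<subseteq> S"
    define N where "N = {t\<in>T. \<exists>s\<in>F. fst t - fst s \<in> K}"
    have finN: "finite N" unfolding N_def using \<open>finite K\<close> fin F(1) by (rule finite_translates)
    have card_copies: "card (copies n Z) = card Z * n" for Z :: "('a \<times> 'd) set"
    proof -
      have "copies n Z = (\<lambda>((x, k), i). (x, k, i)) ` (Z \<times> {..<n})"
        by (force simp: copies_def)
      moreover have "inj_on (\<lambda>((x, k), i). (x, k, i)) (Z \<times> {..<n})" by (auto simp: inj_on_def)
      ultimately show ?thesis by (simp add: card_image card_cartesian_product)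
    qed
    have fin_copies: "finite (copies n N)"
    proof -
      have "copies n N \<subseteq> (\<lambda>((x, k), i). (x, k, i)) ` (N \<times> {..<n})"
        by (force simp: copies_def)
      then show ?thesis using finN by (meson finite_SigmaI finite_imageI finite_lessThan finite_subset)
    qed
    have sub: "copies n F \<subseteq> copies n S" using F by (auto simp: copies_def)
    have "f ` copies n F \<subseteq> copies n N"
    proof
      fix t assume "t \<in> f ` copies n F"
      then obtain s where s: "s \<in> copies n F" "t = f s" by blast
      then have "t \<in> copies n T" "fst t - fst s \<in> K"
        using sub f(2) by (auto simp: K_def displacement_def)
      with s(1) show "t \<in> copies n N" by (force simp: copies_def N_def)
    qed
    then have "card (f ` copies n F) \<le> card (copies n N)" by (rule card_mono[OF fin_copies])
    moreover have "card (f ` copies n F) = card (copies n F)"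
      using f(1) sub by (metis card_image inj_on_subset)
    ultimately show "card F \<le> card {t\<in>T. \<exists>s\<in>F. fst t - fst s \<in> K}"
      using \<open>n \<ge> 1\<close> by (simp add: card_copies N_def)
  qed
qed

section \<open>Invariant means from failure of comparison\<close>

definition translates :: "'g::group_add set \<Rightarrow> 'g set \<Rightarrow> 'g set" where
  "translates K E = (\<lambda>(k, x). k + x) ` (K \<times> E)"

lemma finite_translates_set: "finite K \<Longrightarrow> finite E \<Longrightarrow> finite (translates K E)"
  by (simp add: translates_def)

lemma translatesI: "k \<in> K \<Longrightarrow> x \<in> E \<Longrightarrow> k + x \<in> translates K E"
  unfolding translates_def by (rule image_eqI[of _ _ "(k, x)"]) auto

lemma translatesE:
  assumes "z \<in> translates K E"
  obtains k x where "k \<in> K" "x \<in> E" "z = k + x"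
  using assms by (auto simp: translates_def)

lemma subset_translates: "0 \<in> K \<Longrightarrow> E \<subseteq> translates K E"
  using translatesI[of 0 K _ E] by auto

lemma translates_assoc: "translates K (translates L E) = translates (translates K L) E"
proof (intro equalityI subsetI)
  fix z assume "z \<in> translates K (translates L E)"
  then obtain k l x where "k \<in> K" "l \<in> L" "x \<in> E" "z = (k + l) + x"
    by (auto elim!: translatesE simp: add.assoc)
  then show "z \<in> translates (translates K L) E" by (auto intro!: translatesI)
next
  fix z assume "z \<in> translates (translates K L) E"
  then obtain k l x where "k \<in> K" "l \<in> L" "x \<in> E" "z = k + (l + x)"
    by (auto elim!: translatesE simp: add.assoc)
  then show "z \<in> translates K (translates L E)" by (auto intro!: translatesI)
qed

text \<open>A failed comparison violates Hall's condition for every finite \<open>J\<close>, so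
  \<open>J\<close> can be adapted to the required precision.\<close>

lemma not_tinj_small_neighbourhood:
  fixes S T :: "'g::group_add set"
  assumes "\<not> tinj (S \<times> {0::nat}) (T \<times> {0::nat})" "finite J"
  obtains F where "finite F" "F \<subseteq> S" "card {t\<in>T. \<exists>s\<in>F. t - s \<in> J} < card F"
proof -
  have "\<not> (\<forall>F. finite F \<longrightarrow> F \<subseteq> S \<times> {0::nat} \<longrightarrow>
      card F \<le> card {t\<in>T \<times> {0::nat}. \<exists>s\<in>F. fst t - fst s \<in> J})"
  proof
    assume "\<forall>F. finite F \<longrightarrow> F \<subseteq> S \<times> {0::nat} \<longrightarrow>
      card F \<le> card {t\<in>T \<times> {0::nat}. \<exists>s\<in>F. fst t - fst s \<in> J}"
    moreover have "finite {k. (x, k) \<in> T \<times> {0::nat}}" for x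
      by (rule finite_subset[of _ "{0}"]) auto
    ultimately have "tinj (S \<times> {0::nat}) (T \<times> {0::nat})"
      using assms(2) by (intro tinj_if_hall[of J]) auto
    then show False using assms(1) by contradiction
  qed
  then obtain F where F: "finite F" "F \<subseteq> S \<times> {0::nat}"
      "card {t\<in>T \<times> {0::nat}. \<exists>s\<in>F. fst t - fst s \<in> J} < card F"
    by (auto simp: not_le)
  have F': "F = fst ` F \<times> {0}" using F(2) by force
  then have "card F = card (fst ` F)" by (metis card_cartesian_product card.empty card_insert_disjoint empty_iff finite.emptyI mult.right_neutral One_nat_def)
  moreover have "{t\<in>T \<times> {0::nat}. \<exists>s\<in>F. fst t - fst s \<in> J} = {t\<in>T. \<exists>s\<in>fst ` F. t - s \<in> J} \<times> {0}"
    by force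
  then have "card {t\<in>T \<times> {0::nat}. \<exists>s\<in>F. fst t - fst s \<in> J} = card {t\<in>T. \<exists>s\<in>fst ` F. t - s \<in> J}"
    by (simp add: card_cartesian_product)
  moreover have "finite (fst ` F)" "fst ` F \<subseteq> S" using F by auto
  ultimately show thesis using F(3) by (intro that[of "fst ` F"]) simp_all
qed

text \<open>If \<open>F\<close> violates Hall's condition for a large power of \<open>K\<close>, syndeticity of \<open>T\<close> bounds the
  growth of \<open>F, K F, K\<^sup>2 F, \<dots>\<close>, so one of these sets is almost \<open>K\<close>-invariant.\<close>
lemma folner_set:
  fixes S T :: "'g::group_add set" and e :: real
  assumes ninj: "\<not> tinj (S \<times> {0::nat}) (T \<times> {0::nat})"
    and L: "finite L" "\<And>x. \<exists>l\<in>L. l + x \<in> T"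
    and K: "finite K" "0 \<in> K" and e: "e > 0"
  obtains E where "finite E" "E \<noteq> {}" "card (translates K E) \<le> (1 + e) * card E"
    "card (E \<inter> T) \<le> card (E \<inter> S)"
proof -
  define Kn where "Kn n = (translates K ^^ n) {0}" for n
  have Kn: "finite (Kn n)" for n
    by (induction n) (auto simp: Kn_def finite_translates_set K)
  \<comment> \<open>Growth by a factor above \<open>1 + e\<close> in each of \<open>N\<close> steps
    would multiply the size by more than \<open>card L\<close>, which syndeticity excludes.\<close>
  obtain N where N: "real (card L) < (1 + e) ^ N"
    using real_arch_pow[of "1 + e" "real (card L)"] e by auto
  \<comment> \<open>The element \<open>0\<close> puts the visits to \<open>T\<close> inside
    \<open>Q N\<close> under control; the elements of \<open>L\<close> do the same for the visits to
    \<open>T\<close> reached from \<open>Q N\<close> by \<open>L\<close>.\<close>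
  define J where "J = translates (insert 0 L) (Kn N)"
  have "finite J" using L Kn by (simp add: J_def finite_translates_set)
  obtain F where F: "finite F" "F \<subseteq> S" "card {t\<in>T. \<exists>s\<in>F. t - s \<in> J} < card F"
    using not_tinj_small_neighbourhood[OF ninj \<open>finite J\<close>] .
  define B where "B = {t\<in>T. \<exists>s\<in>F. t - s \<in> J}"
  have finB: "finite B"
  proof (rule finite_subset)
    show "B \<subseteq> translates J F"
    proof
      fix t assume "t \<in> B"
      then obtain s where "s \<in> F" "t - s \<in> J" by (auto simp: B_def)
      then have "(t - s) + s \<in> translates J F" by (intro translatesI)
      then show "t \<in> translates J F" by simp
    qed
  qed (use F \<open>finite J\<close> in \<open>simp add: finite_translates_set\<close>)
  define Q where "Q n = translates (Kn n) F" for n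
  have finQ: "finite (Q n)" for n using F Kn by (simp add: Q_def finite_translates_set)
  have Q0: "Q 0 = F"
    using subset_translates[of "{0}" F] by (auto simp: Q_def Kn_def elim: translatesE)
  have QSuc: "Q (Suc n) = translates K (Q n)" for n
    by (simp add: Q_def Kn_def translates_assoc)
  have Qmono: "Q m \<subseteq> Q n" if "m \<le> n" for m n
    using that by (rule lift_Suc_mono_le[rotated]) (simp add: QSuc subset_translates K)
  have Q_J: "l + x \<in> B" if "x \<in> Q N" "l \<in> insert 0 L" "l + x \<in> T" for l x
  proof -
    obtain k s where ks: "k \<in> Kn N" "s \<in> F" "x = k + s"
      using \<open>x \<in> Q N\<close> unfolding Q_def by (rule translatesE)
    have "l + x - s = l + k" by (simp add: ks(3) add.assoc[symmetric])
    also have "\<dots> \<in> J" unfolding J_def using that(2) ks(1) by (rule translatesI)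
    finally show ?thesis using that(3) ks(2) by (auto simp: B_def)
  qed
  \<comment> \<open>Every point of \<open>Q N\<close> is moved into \<open>B\<close> by some element
    of \<open>L\<close>, so \<open>Q N\<close> has at most \<open>card L * card B\<close>
    elements.\<close>
  have "Q N \<subseteq> (\<Union>l\<in>L. (\<lambda>y. - l + y) ` B)"
  proof
    fix x assume x: "x \<in> Q N"
    obtain l where l: "l \<in> L" "l + x \<in> T" using L by blast
    then have "l + x \<in> B" using Q_J x by blast
    then have "- l + (l + x) \<in> (\<lambda>y. - l + y) ` B" by (rule imageI)
    then show "x \<in> (\<Union>l\<in>L. (\<lambda>y. - l + y) ` B)" using l(1) by auto
  qed
  then have "card (Q N) \<le> card (\<Union>l\<in>L. (\<lambda>y. - l + y) ` B)"
    using L(1) finB by (intro card_mono) auto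
  also have "\<dots> \<le> (\<Sum>l\<in>L. card ((\<lambda>y. - l + y) ` B))" using L(1) by (rule card_UN_le)
  also have "\<dots> \<le> (\<Sum>l\<in>L. card B)" by (intro sum_mono card_image_le finB)
  finally have cardQ: "card (Q N) \<le> card L * card B" by simp
  have "\<exists>n<N. card (Q (Suc n)) \<le> (1 + e) * card (Q n)"
  proof (rule ccontr)
    assume "\<not> (\<exists>n<N. card (Q (Suc n)) \<le> (1 + e) * card (Q n))"
    then have grow: "(1 + e) * card (Q n) < card (Q (Suc n))" if "n < N" for n
      using that not_le by blast
    have "(1 + e) ^ n * card F \<le> card (Q n)" if "n \<le> N" for n
      using that
    proof (induction n)
      case (Suc n)
      have "(1 + e) ^ Suc n * card F = (1 + e) * ((1 + e) ^ n * card F)" by simp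
      also have "\<dots> \<le> (1 + e) * card (Q n)" using Suc e by (intro mult_left_mono) auto
      also have "\<dots> \<le> card (Q (Suc n))" using grow[of n] Suc.prems by simp
      finally show ?case .
    qed (simp add: Q0)
    then have "(1 + e) ^ N * card F \<le> card (Q N)" by simp
    also have "\<dots> \<le> real (card L * card B)" using cardQ by (simp only: of_nat_le_iff)
    also have "\<dots> \<le> real (card L) * card F" using F(3) by (simp add: B_def mult_left_mono)
    also have "\<dots> < (1 + e) ^ N * card F" using N F(3) by (intro mult_strict_right_mono) auto
    finally show False by simp
  qed
  then obtain n where n: "n < N" "card (translates K (Q n)) \<le> (1 + e) * card (Q n)"
    by (auto simp: QSuc)
  \<comment> \<open>The final comparison passes through \<open>F\<close>: visits to \<open>T\<close>
    inside \<open>Q n\<close> lie in \<open>B\<close>, which is smaller than \<open>F\<close>, while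
    \<open>F\<close> itself consists of visits to \<open>S\<close> inside
    \<open>Q n\<close>.\<close>
  have "Q n \<inter> T \<subseteq> B"
    using Q_J[of _ 0] Qmono[of n N] n(1) by auto
  then have "card (Q n \<inter> T) \<le> card B" by (intro card_mono finB)
  also have "\<dots> \<le> card F" using F(3) by (simp add: B_def)
  also have "\<dots> \<le> card (Q n \<inter> S)" using Qmono[of 0 n] F(2) finQ by (intro card_mono) (auto simp: Q0)
  finally have "card (Q n \<inter> T) \<le> card (Q n \<inter> S)" .
  moreover have "Q n \<noteq> {}" using Qmono[of 0 n] F(3) by (auto simp: Q0)
  ultimately show thesis using that finQ n(2) by blast
qed

text \<open>Counting averages over better and better almost invariant sets cluster in the cube of
  functions from subsets to \<open>[0,1]\<close>, compact by Tychonoff. Countability of the group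
  provides an exhaustion by finite sets.\<close>

lemma invariant_mean:
  fixes S T :: "'g::{group_add, countable} set"
  assumes ninj: "\<not> tinj (S \<times> {0::nat}) (T \<times> {0::nat})"
    and L: "finite L" "\<And>x. \<exists>l\<in>L. l + x \<in> T"
  obtains m :: "'g set \<Rightarrow> real" where "\<And>A. 0 \<le> m A" "m UNIV = 1"
    "\<And>A B. A \<inter> B = {} \<Longrightarrow> m (A \<union> B) = m A + m B"
    "\<And>g A. m ((\<lambda>x. g + x) -` A) = m A" "m T \<le> m S"
proof -
  \<comment> \<open>Each \<open>g\<close> belongs to \<open>K n\<close> as soon as
    \<open>to_nat g \<le> n\<close>; inserting \<open>0\<close> makes
    \<open>translates (K n) E\<close> contain \<open>E\<close>.\<close>
  define K where "K n = insert 0 (from_nat ` {..n} :: 'g set)" for n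
  have "\<exists>E. finite E \<and> E \<noteq> {} \<and> card (translates (K n) E) \<le> (1 + 1 / real (Suc n)) * card E \<and>
      card (E \<inter> T) \<le> card (E \<inter> S)" for n
    by (rule folner_set[OF ninj L, of "K n" "1 / real (Suc n)"]) (auto simp: K_def)
  then obtain E where E: "\<And>n. finite (E n)" "\<And>n. E n \<noteq> {}"
      "\<And>n. card (translates (K n) (E n)) \<le> (1 + 1 / real (Suc n)) * card (E n)"
      "\<And>n. card (E n \<inter> T) \<le> card (E n \<inter> S)" by metis
  define \<mu> where "\<mu> n A = card (E n \<inter> A) / card (E n)" for n A
  have card_pos: "0 < card (E n)" for n using E by (simp add: card_gt_0_iff)
  have almost_inv: "\<mu> n ((\<lambda>x. g + x) -` A) \<le> \<mu> n A + 1 / real (Suc n)" if "g \<in> K n" for g A n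
  proof -
    let ?KE = "translates (K n) (E n)"
    have finKE: "finite ?KE" using E(1) by (simp add: finite_translates_set K_def)
    \<comment> \<open>Translation by \<open>g\<close> sends the counted points into
      \<open>E n \<inter> A\<close> or into the boundary \<open>?KE - E n\<close>, and the boundary
      is a small fraction of \<open>E n\<close>.\<close>
    have "card (E n \<inter> (\<lambda>x. g + x) -` A) = card ((\<lambda>x. g + x) ` (E n \<inter> (\<lambda>x. g + x) -` A))"
      by (simp add: card_image)
    also have "\<dots> \<le> card ((E n \<inter> A) \<union> (?KE - E n))"
      using that finKE E(1) by (intro card_mono) (auto intro: translatesI)
    also have "\<dots> \<le> card (E n \<inter> A) + card (?KE - E n)" by (rule card_Un_le)
    also have "card (?KE - E n) = card ?KE - card (E n)"
      using E(1) by (intro card_Diff_subset subset_translates) (auto simp: K_def)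
    finally have "card (E n \<inter> (\<lambda>x. g + x) -` A) \<le> card (E n \<inter> A) + (card ?KE - card (E n))" .
    then have "real (card (E n \<inter> (\<lambda>x. g + x) -` A)) \<le> card (E n \<inter> A) + (real (card ?KE) - card (E n))"
      using card_mono[OF finKE subset_translates[of "K n" "E n"]] by (simp add: K_def of_nat_diff)
    also have "\<dots> \<le> card (E n \<inter> A) + (1 / real (Suc n)) * card (E n)"
      using E(3)[of n] by (simp add: algebra_simps)
    finally have "\<mu> n ((\<lambda>x. g + x) -` A) \<le> (card (E n \<inter> A) + (1 / real (Suc n)) * card (E n)) / card (E n)"
      unfolding \<mu>_def by (rule divide_right_mono) simp
    also have "\<dots> = \<mu> n A + 1 / real (Suc n)"
      using card_pos[of n] by (simp add: \<mu>_def add_divide_distrib)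
    finally show ?thesis .
  qed
  define \<Omega> where "\<Omega> = (PiE UNIV (\<lambda>_. {0..1}) :: ('g set \<Rightarrow> real) set)"
  have "compact \<Omega>"
  proof -
    have "compactin (product_topology (\<lambda>_. euclidean) UNIV) \<Omega>"
      unfolding \<Omega>_def compactin_PiE by simp
    then show ?thesis by (simp add: euclidean_product_topology)
  qed
  define \<F> where "\<F> = filtermap \<mu> sequentially"
  have "\<mu> n \<in> \<Omega>" for n
    using card_pos[of n] E(1) by (auto simp: \<Omega>_def \<mu>_def intro!: card_mono)
  then have "eventually (\<lambda>f. f \<in> \<Omega>) \<F>" by (simp add: \<F>_def eventually_filtermap)
  moreover have "\<F> \<noteq> bot" by (simp add: \<F>_def filtermap_bot_iff)
  \<comment> \<open>A cluster point is enough: every closed condition that the averages eventually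
    satisfy passes to it. All the required properties are closed conditions on finitely many
    coordinates.\<close>
  ultimately obtain m where m: "inf (nhds m) \<F> \<noteq> bot"
    using \<open>compact \<Omega>\<close> unfolding compact_filter by blast
  have limit: "m \<in> C" if "closed C" "eventually (\<lambda>n. \<mu> n \<in> C) sequentially" for C
  proof (rule ccontr)
    assume "m \<notin> C"
    then have "eventually (\<lambda>f. f \<in> - C) (nhds m)"
      using that(1) by (intro eventually_nhds_in_open) auto
    moreover have "eventually (\<lambda>f. f \<in> C) \<F>" using that(2) by (simp add: \<F>_def eventually_filtermap)
    ultimately have "eventually (\<lambda>f. False) (inf (nhds m) \<F>)"
      unfolding eventually_inf by (metis ComplD)
    with m show False by (simp add: eventually_False)
  qed
  note cont = continuous_on_product_coordinates
  have coord: "closed {f :: 'g set \<Rightarrow> real. f A \<le> f B + c}" for A B c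
    by (intro closed_Collect_le continuous_intros cont)
  have "0 \<le> m A" for A
  proof -
    have "m \<in> {f. 0 \<le> f A}"
      by (rule limit) (auto intro!: closed_Collect_le continuous_intros cont simp: \<mu>_def)
    then show ?thesis by simp
  qed
  moreover have "m UNIV = 1"
  proof -
    have "m \<in> {f. f UNIV = 1}"
      using card_pos by (intro limit closed_Collect_eq continuous_intros cont) (simp add: \<mu>_def)
    then show ?thesis by simp
  qed
  moreover have "m (A \<union> B) = m A + m B" if "A \<inter> B = {}" for A B
  proof -
    have "\<mu> n (A \<union> B) = \<mu> n A + \<mu> n B" for n
    proof -
      have "card (E n \<inter> (A \<union> B)) = card (E n \<inter> A) + card (E n \<inter> B)"
        unfolding Int_Un_distrib using E(1) that by (intro card_Un_disjoint) auto
      then show ?thesis by (simp add: \<mu>_def add_divide_distrib)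
    qed
    then have "m \<in> {f. f (A \<union> B) = f A + f B}"
      by (intro limit closed_Collect_eq continuous_intros cont) simp
    then show ?thesis by simp
  qed
  moreover have "m T \<le> m S"
  proof -
    have "\<mu> n T \<le> \<mu> n S" for n using E(4)[of n] by (simp add: \<mu>_def divide_right_mono)
    then have "m \<in> {f. f T \<le> f S}"
      by (intro limit closed_Collect_le continuous_intros cont) simp
    then show ?thesis by simp
  qed
  moreover have "m ((\<lambda>x. g + x) -` A) = m A" for g A
  proof -
    have le: "m ((\<lambda>x. g + x) -` A) \<le> m A" for g A
    proof (rule field_le_epsilon)
      fix e :: real assume "0 < e"
      obtain n0 where n0: "1 / real (Suc n0) < e" using nat_approx_posE[OF \<open>0 < e\<close>] .
      have "\<mu> n ((\<lambda>x. g + x) -` A) \<le> \<mu> n A + e" if n: "max n0 (to_nat g) \<le> n" for n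
      proof -
        have "from_nat (to_nat g) \<in> K n" using n unfolding K_def by (intro insertI2 imageI) simp
        then have "g \<in> K n" by simp
        then have "\<mu> n ((\<lambda>x. g + x) -` A) \<le> \<mu> n A + 1 / real (Suc n)" by (rule almost_inv)
        moreover have "1 / real (Suc n) \<le> 1 / real (Suc n0)" using n by (intro divide_left_mono) auto
        ultimately show ?thesis using n0 by linarith
      qed
      then have "eventually (\<lambda>n. \<mu> n \<in> {f. f ((\<lambda>x. g + x) -` A) \<le> f A + e}) sequentially"
        unfolding eventually_sequentially by (intro exI[of _ "max n0 (to_nat g)"]) simp
      then show "m ((\<lambda>x. g + x) -` A) \<le> m A + e"
        using limit[OF coord] by blast
    qed
    \<comment> \<open>The inequality holds for all group elements and all sets, so its instance for
      \<open>- g\<close> is the reverse one.\<close>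
    have "(\<lambda>x. - g + x) -` ((\<lambda>x. g + x) -` A) = A" by (auto simp: vimage_def)
    then have "m A \<le> m ((\<lambda>x. g + x) -` A)" using le[of "- g" "(\<lambda>x. g + x) -` A"] by simp
    with le show ?thesis by (intro antisym)
  qed
  ultimately show thesis using that by blast
qed

section \<open>Radon measures from contents on clopen sets\<close>

definition clopenin :: "'a topology \<Rightarrow> 'a set \<Rightarrow> bool" where
  "clopenin X C \<longleftrightarrow> closedin X C \<and> openin X C"

lemma clopenin_subset: "clopenin X C \<Longrightarrow> C \<subseteq> topspace X"
  by (simp add: clopenin_def openin_subset)

lemma clopenin_empty: "clopenin X {}"
  by (simp add: clopenin_def)

lemma clopenin_Un: "clopenin X C \<Longrightarrow> clopenin X D \<Longrightarrow> clopenin X (C \<union> D)"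
  by (auto simp: clopenin_def)

lemma clopenin_Diff: "clopenin X C \<Longrightarrow> clopenin X D \<Longrightarrow> clopenin X (C - D)"
  by (simp add: clopenin_def closedin_diff openin_diff)

lemma clopenin_Union: "finite \<F> \<Longrightarrow> (\<And>C. C \<in> \<F> \<Longrightarrow> clopenin X C) \<Longrightarrow> clopenin X (\<Union>\<F>)"
  by (auto simp: clopenin_def intro!: closedin_Union)

lemma clopenin_preimage:
  assumes "continuous_map X X f" "clopenin X C"
  shows "clopenin X (f -` C \<inter> topspace X)"
proof -
  have "f -` C \<inter> topspace X = {x \<in> topspace X. f x \<in> C}" by auto
  with assms show ?thesis
    by (simp add: clopenin_def openin_continuous_map_preimage closedin_continuous_map_preimage)
qed

locale clopen_content =
  fixes X :: "'a topology" and m :: "'a set \<Rightarrow> real"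
  assumes compact: "compact_space X"
    and clopen_basis: "openin X U \<Longrightarrow> x \<in> U \<Longrightarrow> \<exists>C. clopenin X C \<and> x \<in> C \<and> C \<subseteq> U"
    and nonneg: "clopenin X C \<Longrightarrow> 0 \<le> m C"
    and additive: "clopenin X C \<Longrightarrow> clopenin X D \<Longrightarrow> C \<inter> D = {} \<Longrightarrow> m (C \<union> D) = m C + m D"
    and total: "m (topspace X) = 1"
begin

lemma mono: 
  assumes "clopenin X C" "clopenin X D" "C \<subseteq> D"
  shows "m C \<le> m D"
proof -
  have "m (C \<union> (D - C)) = m C + m (D - C)"
    using assms by (intro additive clopenin_Diff) auto
  moreover have "C \<union> (D - C) = D" using assms by auto
  ultimately show ?thesis using nonneg[OF clopenin_Diff[OF assms(2,1)]] by simp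
qed

lemma empty: "m {} = 0"
  using additive[OF clopenin_empty clopenin_empty] by simp

lemma subadditive:
  assumes "clopenin X C" "clopenin X D"
  shows "m (C \<union> D) \<le> m C + m D"
proof -
  have "m (C \<union> (D - C)) = m C + m (D - C)"
    using assms by (intro additive clopenin_Diff) auto
  moreover have "m (D - C) \<le> m D" using assms by (intro mono clopenin_Diff) auto
  ultimately show ?thesis by simp
qed

lemma subadditive_finite:
  fixes n :: nat
  assumes "\<And>i. i < n \<Longrightarrow> clopenin X (V i)"
  shows "clopenin X (\<Union>i<n. V i) \<and> m (\<Union>i<n. V i) \<le> (\<Sum>i<n. m (V i))"
  using assms
proof (induction n)
  case 0
  then show ?case by (simp add: empty clopenin_empty)
next
  case (Suc n)
  have "(\<Union>i<Suc n. V i) = (\<Union>i<n. V i) \<union> V n" by (auto simp: less_Suc_eq)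
  then show ?case
    using Suc.IH Suc.prems clopenin_Un[of X "\<Union>i<n. V i" "V n"] subadditive[of "\<Union>i<n. V i" "V n"] by force
qed

text \<open>Open sets are measured from inside by clopen sets, which are compact here, and
  \<open>outer\<close> measures all sets from outside by open ones. Both regularity clauses of
  \<open>radon_prob\<close> are thus built in.\<close>

definition inner :: "'a set \<Rightarrow> ennreal" where
  "inner U = (SUP C\<in>{C. clopenin X C \<and> C \<subseteq> U}. ennreal (m C))"

definition outer :: "'a set \<Rightarrow> ennreal" where
  "outer E = (INF U\<in>{U. openin X U \<and> E \<subseteq> U}. inner U)"

lemma inner_mono: "U \<subseteq> V \<Longrightarrow> inner U \<le> inner V"
  unfolding inner_def by (intro SUP_subset_mono) auto

lemma inner_upper: "clopenin X C \<Longrightarrow> C \<subseteq> U \<Longrightarrow> ennreal (m C) \<le> inner U"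
  unfolding inner_def by (intro SUP_upper) auto

lemma inner_clopen: "clopenin X C \<Longrightarrow> inner C = ennreal (m C)"
  unfolding inner_def by (intro antisym SUP_least SUP_upper) (auto intro!: ennreal_leI mono)

lemma outer_open: "openin X U \<Longrightarrow> outer U = inner U"
  unfolding outer_def by (intro antisym INF_greatest INF_lower) (auto intro: inner_mono)

lemma outer_le: "openin X U \<Longrightarrow> E \<subseteq> U \<Longrightarrow> outer E \<le> inner U"
  unfolding outer_def by (intro INF_lower) auto

lemma outer_mono: "E \<subseteq> F \<Longrightarrow> outer E \<le> outer F"
  unfolding outer_def by (intro INF_superset_mono) auto

text \<open>Compactness is what upgrades finite additivity: a clopen set inside a countable union of
  open sets is covered by finitely many clopen pieces, each inside one of the open sets.\<close>

lemma inner_Union: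
  assumes U: "\<And>i::nat. openin X (U i)"
  shows "inner (\<Union>i. U i) \<le> (\<Sum>i. inner (U i))"
  unfolding inner_def[of "\<Union>i. U i"]
proof (rule SUP_least, clarify)
  fix C assume C: "clopenin X C" "C \<subseteq> (\<Union>i. U i)"
  define \<D> where "\<D> = {D. clopenin X D \<and> (\<exists>i. D \<subseteq> U i)}"
  have "compactin X C"
    using compact C(1) closedin_compact_space clopenin_def by blast
  moreover have "\<forall>D\<in>\<D>. openin X D" by (auto simp: \<D>_def clopenin_def)
  moreover have "C \<subseteq> \<Union>\<D>"
  proof
    fix x assume "x \<in> C"
    then obtain i where "x \<in> U i" using C by blast
    with clopen_basis[OF U] obtain D where "clopenin X D" "x \<in> D" "D \<subseteq> U i" by blast
    then show "x \<in> \<Union>\<D>" by (auto simp: \<D>_def)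
  qed
  ultimately obtain \<F> where F: "finite \<F>" "\<F> \<subseteq> \<D>" "C \<subseteq> \<Union>\<F>"
    unfolding compactin_def by meson
  have "\<forall>D\<in>\<F>. \<exists>i. D \<subseteq> U i" using F(2) by (auto simp: \<D>_def)
  then obtain k where k: "\<And>D. D \<in> \<F> \<Longrightarrow> D \<subseteq> U (k D)" by metis
  \<comment> \<open>Pieces with the same index are merged, so that each \<open>U i\<close> is
    charged only once.\<close>
  define V where "V i = \<Union>{D\<in>\<F>. k D = i}" for i
  have V: "clopenin X (V i)" for i
    unfolding V_def using F(1,2) by (intro clopenin_Union) (auto simp: \<D>_def)
  have VU: "V i \<subseteq> U i" for i
    unfolding V_def using k by blast
  \<comment> \<open>For empty \<open>\<F>\<close> the maximum is unspecified, but then no index has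
    to be bounded.\<close>
  define n where "n = Suc (Max (k ` \<F>))"
  have "k D < n" if "D \<in> \<F>" for D using that F(1) by (simp add: n_def le_imp_less_Suc)
  then have "C \<subseteq> (\<Union>i<n. V i)" using F(3) by (force simp: V_def)
  then have "m C \<le> (\<Sum>i<n. m (V i))"
    using subadditive_finite[of n V] V mono[OF C(1)] order_trans by blast
  then have "ennreal (m C) \<le> ennreal (\<Sum>i<n. m (V i))" by (rule ennreal_leI)
  also have "\<dots> = (\<Sum>i<n. ennreal (m (V i)))" using V nonneg by simp
  also have "\<dots> \<le> (\<Sum>i<n. inner (U i))" using V VU by (intro sum_mono inner_upper)
  also have "\<dots> \<le> (\<Sum>i. inner (U i))" by (intro sum_le_suminf) auto
  finally show "ennreal (m C) \<le> (\<Sum>i. inner (U i))" .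
qed

lemma outer_empty: "outer {} = 0"
  by (simp add: outer_open inner_clopen[OF clopenin_empty] empty)

lemma outer_measure_space_outer: "outer_measure_space (Pow (topspace X)) outer"
  unfolding outer_measure_space_def
proof (intro conjI)
  show "positive (Pow (topspace X)) outer" by (simp add: positive_def outer_empty)
  show "increasing (Pow (topspace X)) outer" by (simp add: increasing_def outer_mono)
  show "countably_subadditive (Pow (topspace X)) outer"
    unfolding countably_subadditive_def
  proof safe
    fix E :: "nat \<Rightarrow> 'a set"
    show "outer (\<Union>i. E i) \<le> (\<Sum>i. outer (E i))"
    proof (rule ennreal_le_epsilon)
      fix e :: real assume e: "0 < e" "(\<Sum>n. outer (E n)) < top"
      have "\<exists>U. openin X U \<and> E n \<subseteq> U \<and> inner U \<le> outer (E n) + e * (1/2)^Suc n" for n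
      proof -
        have "outer (E n) < top" using e(2) by (auto simp: less_top dest!: ennreal_suminf_lessD)
        then have "outer (E n) < outer (E n) + e * (1/2)^Suc n" using e(1) by (auto simp: less_top)
        then show ?thesis
          unfolding outer_def INF_less_iff by (auto intro: less_imp_le)
      qed
      then obtain U where U: "\<And>n. openin X (U n)" "\<And>n. E n \<subseteq> U n"
          "\<And>n. inner (U n) \<le> outer (E n) + e * (1/2)^Suc n" by metis
      have "outer (\<Union>i. E i) \<le> inner (\<Union>i. U i)"
        using U by (intro outer_le) auto
      also have "\<dots> \<le> (\<Sum>i. inner (U i))" by (rule inner_Union[OF U(1)])
      also have "\<dots> \<le> (\<Sum>n. outer (E n) + e * (1/2)^Suc n)"
        by (intro suminf_le allI U) auto
      also have "\<dots> = (\<Sum>n. outer (E n)) + (\<Sum>n. ennreal e * ennreal ((1/2) ^ Suc n))"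
        using \<open>0 < e\<close> by (subst suminf_add[symmetric])
                         (auto simp del: ennreal_suminf_cmult simp add: ennreal_mult[symmetric])
      also have "\<dots> = (\<Sum>n. outer (E n)) + e"
        unfolding ennreal_suminf_cmult
        by (subst suminf_ennreal_eq[OF zero_le_power power_half_series]) auto
      finally show "outer (\<Union>i. E i) \<le> (\<Sum>n. outer (E n)) + e" .
    qed
  qed
qed

text \<open>For Caratheodory's criterion, approximate from inside twice: \<open>V \<inter> U\<close>
  by a clopen \<open>C\<close>, then the open set \<open>V - C\<close>, which contains
  \<open>V - U\<close>, by a clopen \<open>D\<close>. As \<open>C\<close> and \<open>D\<close> are
  disjoint in \<open>V\<close>, their contents add up to at most \<open>inner V\<close>.\<close>

lemma open_lambda_system:
  assumes "openin X U"
  shows "U \<in> lambda_system (topspace X) (Pow (topspace X)) outer"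
  unfolding algebra.lambda_system_eq[OF algebra_Pow]
proof (intro CollectI conjI ballI antisym)
  show "U \<in> Pow (topspace X)" using assms openin_subset by auto
  fix E assume E: "E \<in> Pow (topspace X)"
  interpret P: sigma_algebra "topspace X" "Pow (topspace X)" by (rule sigma_algebra_Pow)
  have "subadditive (Pow (topspace X)) outer"
    using outer_measure_space_outer P.countably_subadditive_subadditive
    unfolding outer_measure_space_def by blast
  from subadditiveD[OF this, of "E \<inter> U" "E - U"]
  have "outer (E \<inter> U \<union> (E - U)) \<le> outer (E \<inter> U) + outer (E - U)" using E by blast
  then show "outer E \<le> outer (E \<inter> U) + outer (E - U)" by (simp add: Int_Diff_Un)
  show "outer (E \<inter> U) + outer (E - U) \<le> outer E"
    unfolding outer_def[of E]
  proof (rule INF_greatest, clarify)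
    fix V assume V: "openin X V" "E \<subseteq> V"
    have "inner (V \<inter> U) + outer (V - U) =
        (SUP C\<in>{C. clopenin X C \<and> C \<subseteq> V \<inter> U}. ennreal (m C) + outer (V - U))"
      unfolding inner_def using clopenin_empty[of X] by (intro ennreal_SUP_add_left[symmetric]) blast
    also have "\<dots> \<le> inner V"
    proof (rule SUP_least, clarify)
      fix C assume C: "clopenin X C" "C \<subseteq> V \<inter> U"
      have "ennreal (m C) + outer (V - U) \<le> ennreal (m C) + inner (V - C)"
        using C V by (intro add_left_mono outer_le openin_diff) (auto simp: clopenin_def)
      also have "\<dots> = (SUP D\<in>{D. clopenin X D \<and> D \<subseteq> V - C}. ennreal (m C) + ennreal (m D))"
        unfolding inner_def using clopenin_empty[of X] by (intro ennreal_SUP_add_right) blast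
      also have "\<dots> \<le> inner V"
      proof (rule SUP_least, clarify)
        fix D assume D: "clopenin X D" "D \<subseteq> V - C"
        have "C \<inter> D = {}" using D by blast
        have "ennreal (m C) + ennreal (m D) = ennreal (m (C \<union> D))"
          using \<open>C \<inter> D = {}\<close> additive[OF C(1) D(1)] nonneg[OF C(1)] nonneg[OF D(1)] by simp
        also have "\<dots> \<le> inner V" using C D by (intro inner_upper clopenin_Un) auto
        finally show "ennreal (m C) + ennreal (m D) \<le> inner V" .
      qed
      finally show "ennreal (m C) + outer (V - U) \<le> inner V" .
    qed
    finally have "inner (V \<inter> U) + outer (V - U) \<le> inner V" .
    moreover have "outer (E \<inter> U) \<le> inner (V \<inter> U)" using V assms by (intro outer_le) auto
    moreover have "outer (E - U) \<le> outer (V - U)" using V by (intro outer_mono) auto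
    ultimately show "outer (E \<inter> U) + outer (E - U) \<le> inner V"
      by (meson add_mono order_trans)
  qed
qed

definition radon :: "'a measure" where
  "radon = measure_of (topspace X) (borel_sets_of X) outer"

lemma sigma_algebra_borel: "sigma_algebra (topspace X) (borel_sets_of X)"
  unfolding borel_sets_of_def by (intro sigma_algebra_sigma_sets) (auto dest: openin_subset)

lemma borel_subset: "B \<in> borel_sets_of X \<Longrightarrow> B \<subseteq> topspace X"
  unfolding borel_sets_of_def
  by (rule sigma_sets_into_sp[rotated]) (auto dest: openin_subset)

lemma measure_space_outer: "measure_space (topspace X) (borel_sets_of X) outer"
proof -
  let ?L = "lambda_system (topspace X) (Pow (topspace X)) outer"
  have L: "measure_space (topspace X) ?L outer"
    using sigma_algebra.caratheodory_lemma[OF sigma_algebra_Pow outer_measure_space_outer] .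
  then interpret L: sigma_algebra "topspace X" ?L by (simp add: measure_space_def)
  have sub: "borel_sets_of X \<subseteq> ?L"
    unfolding borel_sets_of_def using open_lambda_system by (intro L.sigma_sets_subset) auto
  have "countably_additive (borel_sets_of X) outer"
    unfolding countably_additive_def
  proof (intro allI impI)
    fix A :: "nat \<Rightarrow> 'a set"
    assume "range A \<subseteq> borel_sets_of X" "disjoint_family A" "(\<Union>i. A i) \<in> borel_sets_of X"
    then show "(\<Sum>i. outer (A i)) = outer (\<Union>i. A i)"
      using L sub unfolding measure_space_def countably_additive_def by (meson subset_iff)
  qed
  then show ?thesis
    using sigma_algebra_borel by (simp add: measure_space_def positive_def outer_empty)
qed

lemma space_radon: "space radon = topspace X" and sets_radon: "sets radon = borel_sets_of X"
  using sigma_algebra_borel unfolding radon_def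
  by (simp_all add: space_measure_of_conv sigma_algebra.sets_measure_of_eq)

lemma emeasure_radon: "B \<in> borel_sets_of X \<Longrightarrow> emeasure radon B = outer B"
  using measure_space_outer unfolding radon_def measure_space_def
  by (intro emeasure_measure_of_sigma) auto

lemma open_borel: "openin X U \<Longrightarrow> U \<in> borel_sets_of X"
  by (auto simp: borel_sets_of_def)

lemma outer_topspace: "outer (topspace X) = 1"
  by (simp add: outer_open inner_clopen clopenin_def total)

lemma measure_radon_clopen: "clopenin X C \<Longrightarrow> measure radon C = m C"
  by (simp add: measure_def emeasure_radon open_borel clopenin_def outer_open inner_clopen nonneg)

lemma prob_space_radon: "prob_space radon"
  by (intro prob_spaceI)
    (simp add: space_radon emeasure_radon open_borel outer_topspace)

lemma radon_prob_radon: "radon_prob X radon"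
  unfolding radon_prob_def
proof (intro conjI ballI allI impI prob_space_radon space_radon sets_radon)
  interpret prob_space radon by (rule prob_space_radon)
  fix B assume B: "B \<in> sets radon"
  then have Bb: "B \<in> borel_sets_of X" by (simp add: sets_radon)
  let ?S = "{measure radon U |U. openin X U \<and> B \<subseteq> U}"
  have lower: "measure radon B \<le> z" if "z \<in> ?S" for z
    using that by (auto intro!: finite_measure_mono simp: sets_radon open_borel)
  have ne: "?S \<noteq> {}" using borel_subset[OF Bb] openin_topspace by blast
  show "measure radon B = Inf ?S"
  proof (rule antisym)
    show "measure radon B \<le> Inf ?S" using ne lower by (rule cInf_greatest)
    show "Inf ?S \<le> measure radon B"
    proof (rule field_le_epsilon)
      fix e :: real assume "0 < e"
      then have "outer B < outer B + e"
        using emeasure_radon[OF Bb] emeasure_finite[of B] by (simp add: less_top)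
      then obtain U where U: "openin X U" "B \<subseteq> U" "inner U < outer B + e"
        unfolding outer_def INF_less_iff by auto
      have "ennreal (measure radon U) < ennreal (measure radon B + e)"
        using U \<open>0 < e\<close> Bb
        by (simp add: emeasure_eq_measure[symmetric] emeasure_radon open_borel outer_open)
      then have "measure radon U \<le> measure radon B + e"
        using \<open>0 < e\<close> by (metis ennreal_less_iff less_imp_le measure_nonneg)
      moreover have "Inf ?S \<le> measure radon U"
        using U lower by (intro cInf_lower bdd_belowI[of _ "measure radon B"]) auto
      ultimately show "Inf ?S \<le> measure radon B + e" by linarith
    qed
  qed
next
  interpret prob_space radon by (rule prob_space_radon)
  fix U assume U: "openin X U"
  let ?S = "{measure radon K |K. compactin X K \<and> K \<subseteq> U}"
  have upper: "z \<le> measure radon U" if "z \<in> ?S" for z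
    using that U by (auto intro!: finite_measure_mono simp: sets_radon open_borel)
  have ne: "?S \<noteq> {}" using compactin_empty by blast
  show "measure radon U = Sup ?S"
  proof (rule antisym)
    show "Sup ?S \<le> measure radon U" using ne upper by (rule cSup_least)
    have mC: "m C \<le> Sup ?S" if C: "clopenin X C" "C \<subseteq> U" for C
    proof -
      have "compactin X C" using compact C(1) closedin_compact_space clopenin_def by blast
      then have "measure radon C \<in> ?S" using C(2) by blast
      moreover have "bdd_above ?S" using upper by (rule bdd_aboveI)
      ultimately have "measure radon C \<le> Sup ?S" by (rule cSup_upper)
      then show ?thesis using measure_radon_clopen[OF C(1)] by simp
    qed
    then have "inner U \<le> ennreal (Sup ?S)"
      unfolding inner_def by (intro SUP_least ennreal_leI) blast
    moreover have "0 \<le> Sup ?S"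
      using mC[OF clopenin_empty] unfolding empty by blast
    moreover have "inner U = ennreal (measure radon U)"
      using U by (simp add: emeasure_eq_measure[symmetric] emeasure_radon open_borel outer_open)
    ultimately show "measure radon U \<le> Sup ?S"
      by (simp only: ennreal_le_iff)
  qed
qed

lemma outer_vimage_le:
  assumes f: "continuous_map X X f" and g: "continuous_map X X g"
    and gf: "\<And>x. x \<in> topspace X \<Longrightarrow> g (f x) = x" and fg: "\<And>x. x \<in> topspace X \<Longrightarrow> f (g x) = x"
    and inv: "\<And>C. clopenin X C \<Longrightarrow> m (g -` C \<inter> topspace X) = m C"
  shows "outer (f -` E \<inter> topspace X) \<le> outer E"
  unfolding outer_def[of E]
proof (rule INF_greatest, clarify)
  fix U assume U: "openin X U" "E \<subseteq> U"
  have "f -` U \<inter> topspace X = {x \<in> topspace X. f x \<in> U}" by auto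
  then have "openin X (f -` U \<inter> topspace X)"
    using f U(1) by (simp add: openin_continuous_map_preimage)
  then have "outer (f -` E \<inter> topspace X) \<le> inner (f -` U \<inter> topspace X)"
    using U by (intro outer_le) auto
  also have "\<dots> \<le> inner U"
    unfolding inner_def[of "f -` U \<inter> topspace X"]
  proof (rule SUP_least, clarify)
    fix C assume C: "clopenin X C" "C \<subseteq> f -` U \<inter> topspace X"
    have "g -` C \<inter> topspace X \<subseteq> U" using C(2) fg by force
    then show "ennreal (m C) \<le> inner U"
      using inner_upper[OF clopenin_preimage[OF g C(1)], of U] inv[OF C(1)] by simp
  qed
  finally show "outer (f -` E \<inter> topspace X) \<le> inner U" .
qed

lemma measure_radon_vimage:
  assumes f: "continuous_map X X f" and g: "continuous_map X X g"
    and gf: "\<And>x. x \<in> topspace X \<Longrightarrow> g (f x) = x" and fg: "\<And>x. x \<in> topspace X \<Longrightarrow> f (g x) = x"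
    and invf: "\<And>C. clopenin X C \<Longrightarrow> m (f -` C \<inter> topspace X) = m C"
    and invg: "\<And>C. clopenin X C \<Longrightarrow> m (g -` C \<inter> topspace X) = m C"
    and B: "B \<in> borel_sets_of X"
  shows "measure radon (f -` B \<inter> topspace X) = measure radon B"
proof -
  have "f \<in> measurable radon radon"
    unfolding borel_sets_of_def
  proof (rule measurable_sigma_sets[of _ "topspace X" "{U. openin X U}"])
    show "sets radon = sigma_sets (topspace X) {U. openin X U}" by (simp add: sets_radon borel_sets_of_def)
    show "{U. openin X U} \<subseteq> Pow (topspace X)" by (auto dest: openin_subset)
    show "f \<in> space radon \<rightarrow> topspace X" using f by (simp add: space_radon continuous_map_def)
    fix U assume "U \<in> {U. openin X U}"
    moreover have "f -` U \<inter> topspace X = {x \<in> topspace X. f x \<in> U}" by auto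
    ultimately show "f -` U \<inter> space radon \<in> sets radon"
      using f by (simp add: space_radon sets_radon open_borel openin_continuous_map_preimage)
  qed
  then have meas: "f -` B \<inter> topspace X \<in> borel_sets_of X"
    using B measurable_sets[of f radon radon B] by (simp add: sets_radon space_radon)
  \<comment> \<open>\<open>B\<close> is recovered from its preimage by pulling back along the
    inverse, so the estimate for \<open>g\<close> gives the missing inequality.\<close>
  have "g -` (f -` B \<inter> topspace X) \<inter> topspace X = B"
    using borel_subset[OF B] fg g by (auto simp: continuous_map_def Pi_iff)
  then have "outer B \<le> outer (f -` B \<inter> topspace X)"
    using outer_vimage_le[OF g f fg gf invf, of "f -` B \<inter> topspace X"] by simp
  moreover have "outer (f -` B \<inter> topspace X) \<le> outer B"
    by (rule outer_vimage_le[OF f g gf fg invg])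
  ultimately show ?thesis
    using B meas by (simp add: measure_def emeasure_radon)
qed

end

section \<open>Ultrafilters on a group\<close>

definition basic :: "'g set \<Rightarrow> 'g set set set" where
  "basic S = {p \<in> ultrafilters. S \<in> p}"

lemma ultrafilter_UNIV: "p \<in> ultrafilters \<Longrightarrow> UNIV \<in> p"
  and ultrafilter_empty: "p \<in> ultrafilters \<Longrightarrow> {} \<notin> p"
  and ultrafilter_mono: "p \<in> ultrafilters \<Longrightarrow> A \<in> p \<Longrightarrow> A \<subseteq> B \<Longrightarrow> B \<in> p"
  by (simp_all add: ultrafilters_def)

lemma ultrafilter_Int:
  assumes p: "p \<in> ultrafilters"
  shows "A \<inter> B \<in> p \<longleftrightarrow> A \<in> p \<and> B \<in> p"
proof
  assume "A \<inter> B \<in> p"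
  then show "A \<in> p \<and> B \<in> p" using ultrafilter_mono[OF p, of "A \<inter> B"] by simp
qed (use p in \<open>simp add: ultrafilters_def\<close>)

lemma ultrafilter_Compl:
  assumes p: "p \<in> ultrafilters"
  shows "- A \<in> p \<longleftrightarrow> A \<notin> p"
proof -
  have "A \<in> p \<or> - A \<in> p" using p unfolding ultrafilters_def by blast
  moreover have "\<not> (A \<in> p \<and> - A \<in> p)"
    using ultrafilter_Int[OF p, of A "- A"] ultrafilter_empty[OF p] by simp
  ultimately show ?thesis by blast
qed

lemma ultrafilter_Un:
  assumes p: "p \<in> ultrafilters"
  shows "A \<union> B \<in> p \<longleftrightarrow> A \<in> p \<or> B \<in> p"
  using ultrafilter_Int[OF p, of "- A" "- B"] unfolding Compl_Un[symmetric] ultrafilter_Compl[OF p] by blast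

lemma ultrafilter_nonempty: "p \<in> ultrafilters \<Longrightarrow> A \<in> p \<Longrightarrow> A \<noteq> {}"
  using ultrafilter_empty by blast

lemma ultrafilter_subset_eq:
  assumes "p \<in> ultrafilters" "q \<in> ultrafilters" "p \<subseteq> q"
  shows "p = q"
proof
  show "q \<subseteq> p"
  proof
    fix A assume "A \<in> q"
    then have "- A \<notin> p" using assms ultrafilter_Compl[of q A] by blast
    then show "A \<in> p" using assms ultrafilter_Compl[of p A] by blast
  qed
qed fact

text \<open>A family maximal for the finite intersection property is an ultrafilter: a set
  containing a finite intersection of members can be added, and if adding \<open>A\<close> is
  impossible, some finite intersection of members lies in \<open>- A\<close>.\<close>

lemma ultrafilter_extends:
  assumes fip: "\<And>F. finite F \<Longrightarrow> F \<subseteq> \<S> \<Longrightarrow> \<Inter>F \<noteq> {}"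
  obtains p where "p \<in> ultrafilters" "\<S> \<subseteq> p"
proof -
  define \<A> where "\<A> = {T. \<S> \<subseteq> T \<and> (\<forall>F. finite F \<and> F \<subseteq> T \<longrightarrow> \<Inter>F \<noteq> {})}"
  have "\<exists>p\<in>\<A>. \<forall>T\<in>\<A>. p \<subseteq> T \<longrightarrow> T = p"
  proof (rule subset_Zorn_nonempty)
    show "\<A> \<noteq> {}" using fip by (auto simp: \<A>_def)
    fix \<C> assume C: "\<C> \<noteq> {}" "subset.chain \<A> \<C>"
    have "\<Inter>F \<noteq> {}" if F: "finite F" "F \<subseteq> \<Union>\<C>" for F
    proof -
      obtain T where "T \<in> \<C>" "F \<subseteq> T"
        using finite_subset_Union_chain[OF F C] .
      moreover have "T \<in> \<A>" using C(2) \<open>T \<in> \<C>\<close> unfolding subset_chain_def by blast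
      ultimately show ?thesis using F(1) unfolding \<A>_def by simp
    qed
    moreover have "\<S> \<subseteq> \<Union>\<C>"
    proof -
      obtain T where "T \<in> \<C>" using C(1) by blast
      moreover from this have "T \<in> \<A>" using C(2) unfolding subset_chain_def by blast
      ultimately show ?thesis unfolding \<A>_def by blast
    qed
    ultimately show "\<Union>\<C> \<in> \<A>" by (simp add: \<A>_def)
  qed
  then obtain p where p: "p \<in> \<A>" and max: "\<And>T. T \<in> \<A> \<Longrightarrow> p \<subseteq> T \<Longrightarrow> T = p" by blast
  have fip_p: "\<Inter>F \<noteq> {}" if "finite F" "F \<subseteq> p" for F
    using p that by (auto simp: \<A>_def)
  have mem: "A \<in> p" if G: "finite G" "G \<subseteq> p" "\<Inter>G \<subseteq> A" for A G
  proof -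
    have "\<Inter>F \<noteq> {}" if F: "finite F" "F \<subseteq> insert A p" for F
    proof -
      have "\<Inter>((F - {A}) \<union> G) \<noteq> {}" using F G by (intro fip_p) auto
      moreover have "\<Inter>((F - {A}) \<union> G) \<subseteq> \<Inter>F" using G(3) by blast
      ultimately show ?thesis by blast
    qed
    then have "insert A p \<in> \<A>" using p by (auto simp: \<A>_def)
    then show ?thesis using max[of "insert A p"] by blast
  qed
  have "p \<in> ultrafilters"
    unfolding ultrafilters_def
  proof (intro CollectI conjI allI impI)
    show "UNIV \<in> p" by (rule mem[of "{}"]) auto
    show "{} \<notin> p" using fip_p[of "{{}}"] by auto
    show "A \<inter> B \<in> p" if "A \<in> p" "B \<in> p" for A B using that by (intro mem[of "{A, B}"]) auto
    show "B \<in> p" if "A \<in> p" "A \<subseteq> B" for A B using that by (intro mem[of "{A}"]) auto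
    show "A \<in> p \<or> - A \<in> p" for A
    proof (rule disjCI)
      assume "- A \<notin> p"
      have "insert A p \<in> \<A>"
      proof (rule ccontr)
        assume "insert A p \<notin> \<A>"
        then obtain F where F: "finite F" "F \<subseteq> insert A p" "\<Inter>F = {}"
          using p unfolding \<A>_def by blast
        then have "- A \<in> p" by (intro mem[of "F - {A}"]) blast+
        with \<open>- A \<notin> p\<close> show False by blast
      qed
      then show "A \<in> p" using max[of "insert A p"] by blast
    qed
  qed
  moreover have "\<S> \<subseteq> p" using p by (simp add: \<A>_def)
  ultimately show thesis using that by blast
qed

section \<open>The topology of \<open>\<beta>\<Gamma>\<close>\<close>

lemma topspace_beta: "topspace beta_top = ultrafilters"
proof -
  have "ultrafilters = {p \<in> ultrafilters. UNIV \<in> p}" by (auto simp: ultrafilter_UNIV)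
  then show ?thesis unfolding beta_top_def topology_generated_by_topspace by blast
qed

lemma openin_basic: "openin beta_top (basic S)"
  unfolding beta_top_def basic_def by (rule topology_generated_by_Basis) blast

text \<open>The generating sets form a basis and not merely a subbasis, because ultrafilters are
  closed under intersection.\<close>

lemma openin_beta:
  "openin beta_top U \<longleftrightarrow> U \<subseteq> ultrafilters \<and> (\<forall>p\<in>U. \<exists>S\<in>p. basic S \<subseteq> U)"
proof (intro iffI conjI)
  assume "openin beta_top U"
  then show "U \<subseteq> ultrafilters" using openin_subset topspace_beta by blast
  from \<open>openin beta_top U\<close> have "generate_topology_on {{p \<in> ultrafilters. S \<in> p} | S. True} U"
    unfolding beta_top_def by (rule openin_topology_generated_by)
  then show "\<forall>p\<in>U. \<exists>S\<in>p. basic S \<subseteq> U"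
  proof (induction rule: generate_topology_on.induct)
    case (Int a b)
    show ?case
    proof
      fix p assume p: "p \<in> a \<inter> b"
      obtain S where S: "S \<in> p" "basic S \<subseteq> a" using bspec[OF Int.IH(1), of p] p by auto
      obtain T where T: "T \<in> p" "basic T \<subseteq> b" using bspec[OF Int.IH(2), of p] p by auto
      have "openin beta_top a"
        using Int.hyps(1) by (simp add: beta_top_def openin_topology_generated_by_iff)
      then have "p \<in> ultrafilters" using p openin_subset[of beta_top a] topspace_beta by blast
      moreover have "basic (S \<inter> T) \<subseteq> basic S \<inter> basic T"
        by (auto simp: basic_def ultrafilter_Int)
      ultimately show "\<exists>S\<in>p. basic S \<subseteq> a \<inter> b"
        using S T by (intro bexI[of _ "S \<inter> T"]) (auto simp: ultrafilter_Int)
    qed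
  next
    case (UN K)
    show ?case
    proof
      fix p assume "p \<in> \<Union>K"
      then obtain k where k: "k \<in> K" "p \<in> k" by blast
      then obtain S where "S \<in> p" "basic S \<subseteq> k" using UN.IH by metis
      then show "\<exists>S\<in>p. basic S \<subseteq> \<Union>K" using k(1) by (meson Union_upper order_trans)
    qed
  qed (auto simp: basic_def)
next
  assume U: "U \<subseteq> ultrafilters \<and> (\<forall>p\<in>U. \<exists>S\<in>p. basic S \<subseteq> U)"
  have "U \<subseteq> \<Union>{basic S | S. basic S \<subseteq> U}"
  proof
    fix p assume p: "p \<in> U"
    then obtain S where "S \<in> p" "basic S \<subseteq> U" using U by blast
    moreover have "p \<in> basic S" using p U \<open>S \<in> p\<close> by (auto simp: basic_def)
    ultimately show "p \<in> \<Union>{basic S | S. basic S \<subseteq> U}" by blast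
  qed
  then have "U = \<Union>{basic S | S. basic S \<subseteq> U}" by blast
  moreover have "openin beta_top (\<Union>{basic S | S. basic S \<subseteq> U})"
    by (intro openin_Union) (auto simp: openin_basic)
  ultimately show "openin beta_top U" by simp
qed

lemma closedin_beta_separate:
  assumes "closedin beta_top N" "p \<in> ultrafilters" "p \<notin> N"
  obtains S where "S \<in> p" "basic S \<inter> N = {}"
proof -
  have "openin beta_top (ultrafilters - N)" "p \<in> ultrafilters - N"
    using assms by (auto simp: closedin_def topspace_beta)
  then obtain S where "S \<in> p" "basic S \<subseteq> ultrafilters - N" unfolding openin_beta by meson
  then show thesis using that by blast
qed

lemma compact_space_beta: "compact_space beta_top"
  unfolding compact_space_fip
proof (intro allI impI, elim conjE)
  fix \<U> :: "'a set set set set"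
  assume closed: "\<forall>C\<in>\<U>. closedin beta_top C"
    and fip: "\<forall>\<F>. finite \<F> \<and> \<F> \<subseteq> \<U> \<longrightarrow> \<Inter>\<F> \<noteq> {}"
  show "\<Inter>\<U> \<noteq> {}"
  proof (cases "\<U> = {}")
    case False
    then obtain C0 where C0: "C0 \<in> \<U>" by blast
    then have C0u: "C0 \<subseteq> ultrafilters" using closed closedin_subset topspace_beta by blast
    \<comment> \<open>A closed set is the intersection of the basic sets containing it, so an
      ultrafilter containing all of \<open>\<S>\<close> lies in every member of
      \<open>\<U>\<close>.\<close>
    define \<S> where "\<S> = {S. \<exists>C\<in>\<U>. C \<subseteq> basic S}"
    have "\<Inter>F \<noteq> {}" if F: "finite F" "F \<subseteq> \<S>" for F
    proof -
      have "\<forall>S\<in>F. \<exists>C. C \<in> \<U> \<and> C \<subseteq> basic S" using F(2) by (auto simp: \<S>_def)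
      then obtain c where c: "\<And>S. S \<in> F \<Longrightarrow> c S \<in> \<U>" "\<And>S. S \<in> F \<Longrightarrow> c S \<subseteq> basic S"
        by metis
      \<comment> \<open>Including \<open>C0\<close> ensures that the common point \<open>q\<close>
        is an ultrafilter even if \<open>F\<close> is empty.\<close>
      have "insert C0 (c ` F) \<subseteq> \<U>" "finite (insert C0 (c ` F))" using c(1) C0 F(1) by auto
      then have "\<Inter>(insert C0 (c ` F)) \<noteq> {}" using fip by blast
      then obtain q where q: "q \<in> C0" "\<And>S. S \<in> F \<Longrightarrow> q \<in> c S" by auto
      then have qu: "q \<in> ultrafilters" using C0u by blast
      have "S \<in> q" if "S \<in> F" for S using c(2)[OF that] q(2)[OF that] by (auto simp: basic_def)
      with F(1) have "\<Inter>F \<in> q"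
        by (induction F rule: finite_induct) (auto simp: ultrafilter_Int[OF qu] ultrafilter_UNIV[OF qu])
      then show ?thesis using ultrafilter_nonempty[OF qu] by blast
    qed
    then obtain p where p: "p \<in> ultrafilters" "\<S> \<subseteq> p"
      using ultrafilter_extends by blast
    have "p \<in> C" if C: "C \<in> \<U>" for C
    proof (rule ccontr)
      assume "p \<notin> C"
      then obtain S where S: "S \<in> p" "basic S \<inter> C = {}"
        using closedin_beta_separate closed C p(1) by metis
      have "C \<subseteq> ultrafilters" using closed C closedin_subset topspace_beta by blast
      then have "C \<subseteq> basic (- S)" using S(2) ultrafilter_Compl unfolding basic_def by fast
      then have "- S \<in> p" using p(2) C by (auto simp: \<S>_def)
      then show False using S(1) ultrafilter_Compl[OF p(1)] by blast
    qed
    then show ?thesis by blast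
  qed simp
qed

lemma Hausdorff_space_beta: "Hausdorff_space beta_top"
  unfolding Hausdorff_space_def topspace_beta
proof (intro allI impI, elim conjE)
  fix p q :: "'a set set" assume pq: "p \<in> ultrafilters" "q \<in> ultrafilters" "p \<noteq> q"
  then obtain S where "S \<in> p" "S \<notin> q" using ultrafilter_subset_eq[of p q] by blast
  then have "p \<in> basic S" "q \<in> basic (- S)" "disjnt (basic S) (basic (- S))"
    using pq by (auto simp: basic_def ultrafilter_Compl disjnt_iff)
  then show "\<exists>U V. openin beta_top U \<and> openin beta_top V \<and> p \<in> U \<and> q \<in> V \<and> disjnt U V"
    using openin_basic by blast
qed

text \<open>The hypothesis says that \<open>basic T\<close> pulls back to
  \<open>basic (h T)\<close>. Both translations and right multiplications have this form.\<close>

lemma continuous_map_beta: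
  fixes f :: "'a set set \<Rightarrow> 'b set set"
  assumes "\<And>p. p \<in> ultrafilters \<Longrightarrow> f p \<in> ultrafilters"
    and "\<And>p T. p \<in> ultrafilters \<Longrightarrow> T \<in> f p \<longleftrightarrow> h T \<in> p"
  shows "continuous_map beta_top beta_top f"
  unfolding continuous_map_def topspace_beta
proof (intro conjI allI impI)
  show "f \<in> ultrafilters \<rightarrow> ultrafilters" using assms(1) by blast
  fix U :: "'b set set set" assume "openin beta_top U"
  then have U: "\<And>p. p \<in> U \<Longrightarrow> \<exists>S\<in>p. basic S \<subseteq> U" by (simp add: openin_beta)
  show "openin beta_top {x \<in> ultrafilters. f x \<in> U}"
    unfolding openin_beta
  proof (intro conjI ballI)
    fix p assume "p \<in> {x \<in> ultrafilters. f x \<in> U}"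
    then have p: "p \<in> ultrafilters" "f p \<in> U" by auto
    then obtain S where S: "S \<in> f p" "basic S \<subseteq> U" using U by blast
    then have "h S \<in> p" "basic (h S) \<subseteq> {x \<in> ultrafilters. f x \<in> U}"
      using p assms by (auto simp: basic_def)
    then show "\<exists>S\<in>p. basic S \<subseteq> {x \<in> ultrafilters. f x \<in> U}" by blast
  qed auto
qed

section \<open>Translation and multiplication of ultrafilters\<close>

lemma mem_beta_act: "T \<in> beta_act g p \<longleftrightarrow> (\<lambda>x. g + x) -` T \<in> p"
proof
  assume "T \<in> beta_act g p"
  then obtain S where S: "S \<in> p" "T = (\<lambda>x. g + x) ` S" by (auto simp: beta_act_def)
  have "(\<lambda>x. g + x) -` T = S" unfolding S(2) by (rule inj_vimage_image_eq) simp
  with S show "(\<lambda>x. g + x) -` T \<in> p" by simp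
next
  assume "(\<lambda>x. g + x) -` T \<in> p"
  moreover have "T = (\<lambda>x. g + x) ` ((\<lambda>x. g + x) -` T)"
    by (metis UNIV_I surjI surj_image_vimage_eq add_minus_cancel)
  ultimately show "T \<in> beta_act g p" unfolding beta_act_def by blast
qed

text \<open>Preimages commute with all Boolean operations, which is the advantage of
  \<open>mem_beta_act\<close> over the definition by images.\<close>

lemma ultrafilter_beta_act: "p \<in> ultrafilters \<Longrightarrow> beta_act g p \<in> ultrafilters"
  unfolding ultrafilters_def mem_Collect_eq mem_beta_act vimage_Compl vimage_Int vimage_UNIV vimage_empty
  by (meson vimage_mono)

lemma beta_act_add: "beta_act (g + h) p = beta_act g (beta_act h p)"
  by (rule set_eqI) (simp add: mem_beta_act vimage_def add.assoc)

lemma beta_act_zero: "beta_act 0 p = p"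
  by (rule set_eqI) (simp add: mem_beta_act)

lemma beta_act_minus: "beta_act g (beta_act (- g) p) = p" "beta_act (- g) (beta_act g p) = p"
  by (simp_all flip: beta_act_add add: beta_act_zero)

lemma continuous_map_beta_act: "continuous_map beta_top beta_top (beta_act g)"
  by (rule continuous_map_beta[of _ "\<lambda>T. (\<lambda>x. g + x) -` T"])
    (simp_all add: ultrafilter_beta_act mem_beta_act)

text \<open>The limit of \<open>beta_act x p\<close> as \<open>x\<close> tends to \<open>q\<close>:
  the product of the Stone-Cech compactification that is continuous in its left factor.\<close>

definition umult :: "'g::group_add set set \<Rightarrow> 'g set set \<Rightarrow> 'g set set" where
  "umult q p = {T. {x. T \<in> beta_act x p} \<in> q}"

lemma mem_umult: "T \<in> umult q p \<longleftrightarrow> {x. T \<in> beta_act x p} \<in> q"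
  by (simp add: umult_def)

lemma ultrafilter_umult:
  assumes q: "q \<in> ultrafilters" and p: "p \<in> ultrafilters"
  shows "umult q p \<in> ultrafilters"
proof -
  note act = ultrafilter_beta_act[OF p]
  have "{x. A \<inter> B \<in> beta_act x p} = {x. A \<in> beta_act x p} \<inter> {x. B \<in> beta_act x p}" for A B
    using ultrafilter_Int[OF act] by auto
  moreover have "{x. - A \<in> beta_act x p} = - {x. A \<in> beta_act x p}" for A
    using ultrafilter_Compl[OF act] by auto
  moreover have "{x. A \<in> beta_act x p} \<subseteq> {x. B \<in> beta_act x p}" if "A \<subseteq> B" for A B
    using that ultrafilter_mono[OF act] by blast
  ultimately show ?thesis
    unfolding ultrafilters_def mem_Collect_eq mem_umult
    using ultrafilter_mono[OF q] ultrafilter_Int[OF q] ultrafilter_Compl[OF q]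
      ultrafilter_UNIV[OF q] ultrafilter_empty[OF q]
    by (auto simp: ultrafilter_UNIV[OF act] ultrafilter_empty[OF act])
qed

lemma beta_act_umult: "beta_act g (umult q p) = umult (beta_act g q) p"
proof (rule set_eqI)
  fix T
  have "{x. (\<lambda>x. g + x) -` T \<in> beta_act x p} = (\<lambda>x. g + x) -` {x. T \<in> beta_act x p}"
    by (auto simp: beta_act_add mem_beta_act[of _ g])
  then show "T \<in> beta_act g (umult q p) \<longleftrightarrow> T \<in> umult (beta_act g q) p"
    by (simp add: mem_umult mem_beta_act[of _ g])
qed

text \<open>Once membership is unfolded, this is the equivariance \<open>beta_act_umult\<close> at
  every group element.\<close>

lemma umult_assoc: "umult (umult r q) p = umult r (umult q p)"
proof (rule set_eqI)
  fix T
  have "T \<in> umult (umult r q) p \<longleftrightarrow> {x. {y. T \<in> beta_act y p} \<in> beta_act x q} \<in> r"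
    by (simp only: mem_umult)
  also have "\<dots> \<longleftrightarrow> T \<in> umult r (umult q p)"
    by (simp only: mem_umult beta_act_umult)
  finally show "T \<in> umult (umult r q) p \<longleftrightarrow> T \<in> umult r (umult q p)" .
qed

lemma continuous_map_umult:
  assumes "p \<in> ultrafilters"
  shows "continuous_map beta_top beta_top (\<lambda>q. umult q p)"
  by (rule continuous_map_beta[of _ "\<lambda>T. {x. T \<in> beta_act x p}"])
    (simp_all add: ultrafilter_umult assms mem_umult)

lemma closedin_umult_image:
  assumes "p \<in> ultrafilters" "closedin beta_top N"
  shows "closedin beta_top ((\<lambda>q. umult q p) ` N)"
proof -
  have "compactin beta_top N" using compact_space_beta assms(2) by (rule closedin_compact_space)
  then have "compactin beta_top ((\<lambda>q. umult q p) ` N)"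
    using continuous_map_umult[OF assms(1)] by (rule image_compactin)
  with Hausdorff_space_beta show ?thesis by (rule compactin_imp_closedin)
qed

lemma chain_Inter_nonempty:
  assumes "compact_space X" "\<C> \<noteq> {}" "subset.chain \<A> \<C>"
    and closed: "\<And>C. C \<in> \<C> \<Longrightarrow> closedin X C \<and> C \<noteq> {}"
  shows "\<Inter>\<C> \<noteq> {}"
proof -
  have "\<Inter>\<F> \<noteq> {}" if F: "finite \<F>" "\<F> \<subseteq> \<C>" for \<F>
  proof (cases "\<F> = {}")
    case False
    have "subset.chain \<A> \<F>" 
      using assms(3) F(2) unfolding subset_chain_def by (meson subset_iff)
    then have "\<Inter>\<F> \<in> \<F>" using F(1) False by (intro Inter_in_chain)
    then show ?thesis using closed F(2) by (meson subsetD)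
  qed simp
  then show ?thesis using assms(1) closed unfolding compact_space_fip by meson
qed

section \<open>Minimal subflows as left ideals\<close>

lemma minimal_subflow_ultrafilters: "minimal_subflow M \<Longrightarrow> M \<subseteq> ultrafilters"
  by (simp add: minimal_subflow_def closedin_subset flip: topspace_beta)

text \<open>The product is a limit of points in the orbit of \<open>p\<close>: a basic neighbourhood
  of it missing \<open>M\<close> would contain some \<open>beta_act x p\<close>.\<close>

lemma minimal_subflow_umult:
  assumes M: "minimal_subflow M" and "q \<in> ultrafilters" "p \<in> M"
  shows "umult q p \<in> M"
proof (rule ccontr)
  assume "umult q p \<notin> M"
  moreover have pu: "p \<in> ultrafilters" using assms minimal_subflow_ultrafilters by blast
  moreover have "closedin beta_top M" using M by (simp add: minimal_subflow_def)
  ultimately obtain S where S: "S \<in> umult q p" "basic S \<inter> M = {}"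
    using closedin_beta_separate ultrafilter_umult assms(2) by metis
  then have "{x. S \<in> beta_act x p} \<noteq> {}"
    using ultrafilter_nonempty[OF assms(2)] by (simp only: mem_umult) blast
  then obtain x where "S \<in> beta_act x p" by blast
  moreover have "beta_act x p \<in> M" using assms by (auto simp: minimal_subflow_def)
  ultimately show False using S(2) ultrafilter_beta_act[OF pu] by (auto simp: basic_def)
qed

text \<open>Right multiplication is continuous and equivariant, so the image is a nonempty closed
  invariant subset of \<open>M\<close>, and minimality applies.\<close>

lemma minimal_subflow_umult_image:
  assumes M: "minimal_subflow M" and "p \<in> M"
  shows "(\<lambda>q. umult q p) ` M = M"
proof -
  have Mu: "M \<subseteq> ultrafilters" using M by (rule minimal_subflow_ultrafilters)
  have "(\<lambda>q. umult q p) ` M \<subseteq> M"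
  proof
    fix r assume "r \<in> (\<lambda>q. umult q p) ` M"
    then obtain q where "r = umult q p" "q \<in> M" by blast
    then show "r \<in> M" using minimal_subflow_umult[OF M _ \<open>p \<in> M\<close>] Mu by blast
  qed
  moreover have "(\<lambda>q. umult q p) ` M \<noteq> {}" using M by (simp add: minimal_subflow_def)
  moreover have "closedin beta_top ((\<lambda>q. umult q p) ` M)"
    using M Mu \<open>p \<in> M\<close> by (intro closedin_umult_image) (auto simp: minimal_subflow_def)
  moreover have "beta_act g ` (\<lambda>q. umult q p) ` M \<subseteq> (\<lambda>q. umult q p) ` M" for g
    using M by (auto simp: minimal_subflow_def beta_act_umult image_subset_iff)
  ultimately show ?thesis using M unfolding minimal_subflow_def by blast
qed

text \<open>The Ellis--Numakura lemma: in a minimal closed subsemigroup, every element is idempotent.\<close>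
lemma minimal_subflow_idempotent:
  assumes M: "minimal_subflow M"
  obtains p where "p \<in> M" "umult p p = p"
proof -
  define \<A> where "\<A> = {N. N \<subseteq> M \<and> N \<noteq> {} \<and> closedin beta_top N \<and> (\<forall>a\<in>N. \<forall>b\<in>N. umult a b \<in> N)}"
  have Mu: "M \<subseteq> ultrafilters" using M by (rule minimal_subflow_ultrafilters)
  obtain N where N: "N \<in> \<A>" and min: "\<And>N'. N' \<in> \<A> \<Longrightarrow> N' \<subseteq> N \<Longrightarrow> N' = N"
  proof (rule minimal_element_Inter[of \<A>])
    have "M \<in> \<A>"
      using M Mu minimal_subflow_umult[OF M] by (auto simp: \<A>_def minimal_subflow_def)
    then show "\<A> \<noteq> {}" by blast
    fix \<C> assume C: "\<C> \<noteq> {}" "subset.chain \<A> \<C>"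
    then have CA: "\<C> \<subseteq> \<A>" by (simp add: subset_chain_def)
    have "\<Inter>\<C> \<noteq> {}"
      using CA by (intro chain_Inter_nonempty[OF compact_space_beta C]) (auto simp: \<A>_def)
    moreover have "closedin beta_top (\<Inter>\<C>)"
      using CA C(1) by (intro closedin_Inter) (auto simp: \<A>_def)
    moreover have "\<Inter>\<C> \<subseteq> M" using CA C(1) unfolding \<A>_def by blast
    moreover have "umult a b \<in> \<Inter>\<C>" if "a \<in> \<Inter>\<C>" "b \<in> \<Inter>\<C>" for a b
      using CA that unfolding \<A>_def by blast
    ultimately show "\<Inter>\<C> \<in> \<A>" by (simp add: \<A>_def)
  qed blast
  have N': "N \<subseteq> M" "closedin beta_top N" "\<And>a b. a \<in> N \<Longrightarrow> b \<in> N \<Longrightarrow> umult a b \<in> N" "N \<noteq> {}"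
    using N by (auto simp: \<A>_def)
  then obtain p where p: "p \<in> N" by blast
  then have pu: "p \<in> ultrafilters" using N' Mu by blast
  let ?Np = "(\<lambda>q. umult q p) ` N"
  have "?Np \<in> \<A>"
    unfolding \<A>_def
  proof (intro CollectI conjI ballI)
    show "?Np \<subseteq> M" using N' p by blast
    show "?Np \<noteq> {}" using p by blast
    show "closedin beta_top ?Np" using pu N'(2) by (rule closedin_umult_image)
    fix a b assume "a \<in> ?Np" "b \<in> ?Np"
    then obtain a' b' where "a = umult a' p" "b = umult b' p" "a' \<in> N" "b' \<in> N" by blast
    then have "umult a b = umult (umult (umult a' p) b') p" "umult (umult a' p) b' \<in> N"
      using N'(3) p by (simp_all add: umult_assoc)
    then show "umult a b \<in> ?Np" by blast
  qed
  then have "?Np = N" using min N'(3) p by blast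
  \<comment> \<open>Since \<open>N p = N\<close>, some \<open>q\<close> in \<open>N\<close> solves
    \<open>q p = p\<close>. The solutions again form a closed subsemigroup, hence all of
    \<open>N\<close>, and in particular \<open>p\<close> is a solution.\<close>
  define L where "L = {q \<in> N. umult q p = p}"
  have "L \<in> \<A>"
    unfolding \<A>_def
  proof (intro CollectI conjI ballI)
    show "L \<subseteq> M" using N' by (auto simp: L_def)
    have "p \<in> ?Np" using \<open>?Np = N\<close> p by simp
    then obtain q where "q \<in> N" "p = umult q p" by (rule imageE)
    then show "L \<noteq> {}" unfolding L_def by auto
    have "closedin beta_top {p}"
      using pu closedin_t1_singleton[OF Hausdorff_imp_t1_space[OF Hausdorff_space_beta]]
      by (simp add: topspace_beta)
    then have "closedin beta_top {q \<in> topspace beta_top. umult q p \<in> {p}}"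
      using continuous_map_umult[OF pu] by (rule closedin_continuous_map_preimage[rotated])
    then have "closedin beta_top ({q \<in> topspace beta_top. umult q p \<in> {p}} \<inter> N)"
      using N'(2) by (rule closedin_Int)
    moreover have "{q \<in> topspace beta_top. umult q p \<in> {p}} \<inter> N = L"
      using N'(1) Mu unfolding L_def topspace_beta by blast
    ultimately show "closedin beta_top L" by simp
    fix a b assume "a \<in> L" "b \<in> L"
    then show "umult a b \<in> L" using N'(3)[of a b] by (simp add: L_def umult_assoc)
  qed
  then have "L = N" by (rule min) (simp add: L_def)
  then have "umult p p = p" using p by (auto simp: L_def)
  then show thesis using that p N'(1) by blast
qed

text \<open>Every \<open>q\<close> in \<open>M\<close> is of the form \<open>r p\<close>, and the
  idempotent \<open>p\<close> absorbs one more factor \<open>p\<close>.\<close>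

lemma minimal_subflow_right_identity:
  assumes M: "minimal_subflow M"
  obtains p where "p \<in> M" "\<And>q. q \<in> M \<Longrightarrow> umult q p = q"
proof -
  obtain p where p: "p \<in> M" "umult p p = p" using minimal_subflow_idempotent[OF M] .
  have "umult q p = q" if "q \<in> M" for q
  proof -
    have "q \<in> (\<lambda>q. umult q p) ` M" using minimal_subflow_umult_image[OF M p(1)] that by simp
    then obtain r where "q = umult r p" by blast
    then show ?thesis by (simp add: umult_assoc p(2))
  qed
  then show thesis using that p(1) by blast
qed

section \<open>The type semigroup of a minimal subflow\<close>

definition slice :: "('x \<times> nat) set \<Rightarrow> nat \<Rightarrow> 'x set" where
  "slice A n = {q. (q, n) \<in> A}"

lemma openin_Ytop: "openin (Ytop X) A \<longleftrightarrow> (\<forall>n. openin X (slice A n))"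
proof safe
  fix n assume A: "openin (Ytop X) A"
  have "continuous_map X (Ytop X) (\<lambda>q. (q, n))"
    by (simp add: Ytop_def continuous_map_paired)
  then have "openin X {q \<in> topspace X. (q, n) \<in> A}"
    using A by (rule openin_continuous_map_preimage)
  moreover have "{q \<in> topspace X. (q, n) \<in> A} = slice A n"
    using openin_subset[OF A] by (auto simp: slice_def Ytop_def)
  ultimately show "openin X (slice A n)" by simp
next
  assume "\<forall>n. openin X (slice A n)"
  then have "openin (Ytop X) (\<Union>n. slice A n \<times> {n})"
    by (intro openin_Union) (auto simp: Ytop_def openin_prod_Times_iff)
  moreover have "(\<Union>n. slice A n \<times> {n}) = A" by (auto simp: slice_def)
  ultimately show "openin (Ytop X) A" by simp
qed

lemma closedin_Ytop: "closedin (Ytop X) A \<longleftrightarrow> (\<forall>n. closedin X (slice A n))"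
proof -
  have "slice (topspace (Ytop X) - A) n = topspace X - slice A n" for n
    by (auto simp: slice_def Ytop_def)
  moreover have "A \<subseteq> topspace (Ytop X) \<longleftrightarrow> (\<forall>n. slice A n \<subseteq> topspace X)"
    by (auto simp: slice_def Ytop_def)
  ultimately show ?thesis unfolding closedin_def openin_Ytop by auto
qed

lemma bounded_clopen_iff:
  "bounded_clopen X A \<longleftrightarrow> (\<forall>n. clopenin X (slice A n)) \<and> (\<exists>N. \<forall>(x, n)\<in>A. n < N)"
  unfolding bounded_clopen_def openin_Ytop closedin_Ytop clopenin_def by (auto simp: Ball_def)

lemma bounded_clopen_empty: "bounded_clopen X {}"
  by (simp add: bounded_clopen_iff slice_def clopenin_empty)

lemma bounded_clopen_bound:
  assumes "bounded_clopen X A"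
  obtains N where "\<And>x n. (x, n) \<in> A \<Longrightarrow> n < N"
  using assms unfolding bounded_clopen_def by blast

lemma bounded_clopen_Un:
  assumes "bounded_clopen X A" "bounded_clopen X B"
  shows "bounded_clopen X (A \<union> B)"
proof -
  obtain N where N: "\<And>x n. (x, n) \<in> A \<Longrightarrow> n < N" using assms(1) by (rule bounded_clopen_bound) blast
  obtain N' where N': "\<And>x n. (x, n) \<in> B \<Longrightarrow> n < N'" using assms(2) by (rule bounded_clopen_bound) blast
  have "\<forall>x n. (x, n) \<in> A \<union> B \<longrightarrow> n < max N N'" using N N' by (auto simp: less_max_iff_disj)
  with assms show ?thesis unfolding bounded_clopen_def by blast
qed

lemma bounded_clopen_level:
  assumes "clopenin X C"
  shows "bounded_clopen X (C \<times> {0})"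
proof -
  have "slice (C \<times> {0}) n = (if n = 0 then C else {})" for n by (auto simp: slice_def)
  with assms show ?thesis
    unfolding bounded_clopen_iff by (auto simp: clopenin_empty intro!: exI[of _ 1])
qed

definition tshift :: "'g::group_add \<Rightarrow> ('b \<Rightarrow> 'c) \<Rightarrow> 'g \<times> 'b \<Rightarrow> 'g \<times> 'c" where
  "tshift g s = (\<lambda>(x, n). (g + x, s n))"

lemma tshift_simp [simp]: "tshift g s (x, n) = (g + x, s n)"
  by (simp add: tshift_def)

lemma displacement_tshift: "displacement (tshift g s) z = g"
  by (cases z) (simp add: displacement_def add_diff_eq)

text \<open>Injectivity of \<open>s\<close> is the right generality: levels will be moved by
  permutations, but also upwards by a constant.\<close>

lemma teq_tshift: "inj s \<Longrightarrow> teq S (tshift g s ` S)"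
  unfolding teq_def
proof (intro exI[of _ "tshift g s"] conjI)
  assume "inj s"
  then show "bij_betw (tshift g s) S (tshift g s ` S)"
    by (intro bij_betw_imageI) (auto simp: inj_on_def)
  show "finite (displacement (tshift g s) ` S)"
    by (rule finite_subset[of _ "{g}"]) (auto simp: displacement_tshift)
qed

text \<open>Clopen sets are compared with sets of group elements through the orbit of a right identity
  \<open>p\<close> of the left ideal \<open>M\<close>.\<close>
locale minimal_flow =
  fixes M :: "'g::{group_add, countable} set set set" and p :: "'g set set"
  assumes minimal: "minimal_subflow M" and p_in: "p \<in> M"
    and right_identity: "q \<in> M \<Longrightarrow> umult q p = q"
begin

abbreviation X :: "'g set set topology" where
  "X \<equiv> subtopology beta_top M"

lemma ultrafilter: "q \<in> M \<Longrightarrow> q \<in> ultrafilters"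
  using minimal_subflow_ultrafilters[OF minimal] by blast

lemma act_in: "q \<in> M \<Longrightarrow> beta_act g q \<in> M"
  using minimal by (auto simp: minimal_subflow_def)

lemma topspace_beta_Int [simp]: "topspace beta_top \<inter> M = M"
  using minimal_subflow_ultrafilters[OF minimal] by (auto simp: topspace_beta)

lemma topspace_X: "topspace X = M"
  by simp

lemma closed_M: "closedin beta_top M"
  using minimal by (simp add: minimal_subflow_def)

lemma compact_space_X: "compact_space X"
  using closedin_compact_space[OF compact_space_beta closed_M] by (rule compact_space_subtopology)

section \<open>Visiting times and the clopen sets they determine\<close>

definition hits :: "'g set set set \<Rightarrow> 'g set" where
  "hits C = {x. beta_act x p \<in> C}"

definition limits :: "'g set \<Rightarrow> 'g set set set" where
  "limits S = {q \<in> M. S \<in> q}"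

lemma openin_limits: "openin X (limits S)"
proof -
  have "limits S = basic S \<inter> M" by (auto simp: limits_def basic_def ultrafilter)
  then show ?thesis using openin_basic openin_subtopology by metis
qed

text \<open>Exactly one of \<open>S\<close> and \<open>- S\<close> belongs to each ultrafilter, so
  an arbitrary set of group elements yields a clopen set.\<close>

lemma clopenin_limits: "clopenin X (limits S)"
proof -
  have "topspace X - limits S = limits (- S)"
    unfolding topspace_X by (auto simp: limits_def ultrafilter_Compl ultrafilter)
  moreover have "limits S \<subseteq> topspace X" unfolding topspace_X by (auto simp: limits_def)
  ultimately show ?thesis by (simp add: clopenin_def closedin_def openin_limits)
qed

lemma openin_X_limits:
  assumes "openin X U" "q \<in> U"
  obtains S where "S \<in> q" "q \<in> limits S" "limits S \<subseteq> U"
proof -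
  obtain V where V: "openin beta_top V" "U = V \<inter> M"
    using assms(1) by (auto simp: openin_subtopology)
  then obtain S where S: "S \<in> q" "basic S \<subseteq> V"
    using assms(2) unfolding openin_beta by auto
  moreover have "limits S \<subseteq> U" using S(2) V(2) by (auto simp: limits_def basic_def ultrafilter)
  moreover have "q \<in> limits S" using S(1) V(2) assms(2) by (simp add: limits_def)
  ultimately show thesis using that by blast
qed

text \<open>Here the right identity enters: \<open>q = umult q p\<close> means that a set
  \<open>S\<close> in \<open>q\<close> also lies in \<open>beta_act x p\<close> for
  \<open>q\<close>-almost all \<open>x\<close>.\<close>

lemma hits_open:
  assumes "openin X U" "q \<in> U"
  shows "hits U \<in> q"
proof -
  obtain S where S: "S \<in> q" "limits S \<subseteq> U" using openin_X_limits[OF assms] .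
  have "q \<in> M" using assms openin_subset topspace_X by blast
  then have "{x. S \<in> beta_act x p} \<in> q"
    using S(1) right_identity by (simp flip: mem_umult)
  moreover have "{x. S \<in> beta_act x p} \<subseteq> hits U"
    using S(2) act_in[OF p_in] by (auto simp: hits_def limits_def)
  ultimately show ?thesis using ultrafilter_mono[OF ultrafilter[OF \<open>q \<in> M\<close>]] by blast
qed

text \<open>Use \<open>hits_open\<close> for \<open>C\<close> and for its complement. In the other
  order, \<open>hits (limits S)\<close> may well differ from \<open>S\<close>, so this is a
  retraction and not a bijection.\<close>

lemma limits_hits:
  assumes "clopenin X C"
  shows "limits (hits C) = C"
proof (intro equalityI subsetI)
  fix q assume q: "q \<in> limits (hits C)"
  then have "q \<in> M" "hits C \<in> q" by (auto simp: limits_def)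
  show "q \<in> C"
  proof (rule ccontr)
    assume "q \<notin> C"
    moreover have "openin X (M - C)" using assms topspace_X by (metis clopenin_def closedin_def)
    ultimately have "hits (M - C) \<in> q" using \<open>q \<in> M\<close> by (intro hits_open) auto
    then have "hits (M - C) \<inter> hits C \<in> q"
      using \<open>hits C \<in> q\<close> ultrafilter_Int[OF ultrafilter[OF \<open>q \<in> M\<close>]] by blast
    moreover have "hits (M - C) \<inter> hits C = {}" by (auto simp: hits_def)
    ultimately show False using ultrafilter_empty[OF ultrafilter[OF \<open>q \<in> M\<close>]] by simp
  qed
next
  fix q assume "q \<in> C"
  moreover have "C \<subseteq> M" using clopenin_subset[OF assms] topspace_X by simp
  ultimately show "q \<in> limits (hits C)"
    using hits_open assms by (auto simp: limits_def clopenin_def)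
qed

text \<open>\<open>ret\<close> and \<open>ext\<close> are \<open>hits\<close> and
  \<open>limits\<close> taken level by level.\<close>

definition ret :: "('g set set \<times> nat) set \<Rightarrow> ('g \<times> nat) set" where
  "ret A = {(x, n). (beta_act x p, n) \<in> A}"

definition ext :: "('g \<times> nat) set \<Rightarrow> ('g set set \<times> nat) set" where
  "ext S = {(q, n). q \<in> M \<and> {x. (x, n) \<in> S} \<in> q}"

lemma ret_Un: "ret (A \<union> B) = ret A \<union> ret B"
  by (auto simp: ret_def)

lemma ret_disjoint: "A \<inter> B = {} \<Longrightarrow> ret A \<inter> ret B = {}"
  by (auto simp: ret_def)

lemma finite_ret_fibre:
  assumes "bounded_clopen X A"
  shows "finite {k. (x, k) \<in> ret A}"
proof -
  obtain N where "\<And>x n. (x, n) \<in> A \<Longrightarrow> n < N" using assms by (rule bounded_clopen_bound) blast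
  then have "{k. (x, k) \<in> ret A} \<subseteq> {..<N}" by (auto simp: ret_def)
  then show ?thesis by (rule finite_subset) simp
qed

lemma slice_ext: "slice (ext S) n = limits {x. (x, n) \<in> S}"
  by (simp add: slice_def ext_def limits_def)

lemma ext_ret:
  assumes "bounded_clopen X A"
  shows "ext (ret A) = A"
proof -
  have "slice (ext (ret A)) n = slice A n" for n
  proof -
    have "slice (ext (ret A)) n = limits (hits (slice A n))"
      unfolding slice_ext by (simp add: ret_def hits_def slice_def)
    also have "\<dots> = slice A n" using assms by (intro limits_hits) (simp add: bounded_clopen_iff)
    finally show ?thesis .
  qed
  then show ?thesis by (auto simp: slice_def set_eq_iff)
qed

lemma ext_level: "(q, n) \<in> ext S \<Longrightarrow> \<exists>x. (x, n) \<in> S"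
  using ultrafilter_nonempty ultrafilter by (fastforce simp: ext_def)

lemma bounded_clopen_ext:
  assumes "\<And>x n. (x, n) \<in> S \<Longrightarrow> n < N"
  shows "bounded_clopen X (ext S)"
  unfolding bounded_clopen_iff slice_ext using assms ext_level[of _ _ S] clopenin_limits by blast

lemma ext_empty: "ext {} = {}"
  using ext_level by fastforce

text \<open>Primeness of ultrafilters handles finite unions, which is why comparison maps must have
  finitely many pieces.\<close>

lemma ext_Un: "ext (S \<union> T) = ext S \<union> ext T"
proof -
  have "{x. (x, n) \<in> S \<union> T} = {x. (x, n) \<in> S} \<union> {x. (x, n) \<in> T}" for n by auto
  then show ?thesis by (auto simp: ext_def ultrafilter_Un ultrafilter)
qed

lemma ext_UN: "ext (\<Union>i<(n::nat). S i) = (\<Union>i<n. ext (S i))"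
  by (induction n) (simp_all add: ext_empty ext_Un lessThan_Suc)

lemma ext_disjoint:
  assumes "S \<inter> T = {}"
  shows "ext S \<inter> ext T = {}"
proof -
  have False if "q \<in> M" "{x. (x, n) \<in> S} \<in> q" "{x. (x, n) \<in> T} \<in> q" for q n
  proof -
    have "{x. (x, n) \<in> S} \<inter> {x. (x, n) \<in> T} \<in> q"
      using that ultrafilter_Int[OF ultrafilter] by blast
    moreover have "{x. (x, n) \<in> S} \<inter> {x. (x, n) \<in> T} = {}" using assms by auto
    ultimately show False using ultrafilter_empty[OF ultrafilter[OF that(1)]] by simp
  qed
  then show ?thesis by (auto simp: ext_def)
qed

lemma ret_tact:
  assumes "bij s"
  shows "ret (tact beta_act g s ` A) = tshift g s ` ret A"
proof (intro equalityI subsetI)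
  fix z assume "z \<in> ret (tact beta_act g s ` A)"
  then obtain y q n where z: "z = (y, s n)" "beta_act y p = beta_act g q" "(q, n) \<in> A"
    by (auto simp: ret_def tact_def)
  then have "q = beta_act (- g + y) p" by (simp add: beta_act_add beta_act_minus)
  then have "(- g + y, n) \<in> ret A" using z(3) by (simp add: ret_def)
  then have "tshift g s (- g + y, n) \<in> tshift g s ` ret A" by (rule imageI)
  then show "z \<in> tshift g s ` ret A" by (simp add: z(1))
next
  fix z assume "z \<in> tshift g s ` ret A"
  then obtain x n where z: "z = (g + x, s n)" "(beta_act x p, n) \<in> A" by (auto simp: ret_def)
  then have "tact beta_act g s (beta_act x p, n) \<in> tact beta_act g s ` A" by blast
  then show "z \<in> ret (tact beta_act g s ` A)" by (simp add: z(1) ret_def tact_def beta_act_add)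
qed

text \<open>Injectivity of \<open>s\<close> keeps the levels apart, and surjectivity ensures that
  every level of the right-hand side comes from one of \<open>S\<close>.\<close>

lemma tact_ext:
  assumes "bij s"
  shows "tact beta_act g s ` ext S = ext (tshift g s ` S)"
proof -
  have mem: "{x. (g + x, s n) \<in> tshift g s ` S} = {x. (x, n) \<in> S}" for n
    using bij_is_inj[OF assms] by (force dest: injD)
  show ?thesis
  proof (intro equalityI subsetI)
    fix z assume "z \<in> tact beta_act g s ` ext S"
    then obtain q n where "z = (beta_act g q, s n)" "q \<in> M" "{x. (x, n) \<in> S} \<in> q"
      by (auto simp: tact_def ext_def)
    then show "z \<in> ext (tshift g s ` S)"
      using mem[of n] act_in by (simp add: ext_def mem_beta_act vimage_def)
  next
    fix z assume "z \<in> ext (tshift g s ` S)"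
    moreover obtain q m where "z = (q, m)" by (cases z)
    moreover obtain n where "m = s n" using bij_is_surj[OF assms] by (metis surjD)
    ultimately have z: "z = (q, s n)" "q \<in> M" "{y. (y, s n) \<in> tshift g s ` S} \<in> q"
      by (auto simp: ext_def)
    have "{y. (y, s n) \<in> tshift g s ` S} \<in> beta_act g (beta_act (- g) q)"
      using z(3) by (simp add: beta_act_minus)
    then have "{x. (x, n) \<in> S} \<in> beta_act (- g) q"
      using mem[of n] by (simp only: mem_beta_act[of _ g] vimage_def mem_Collect_eq)
    then have "(beta_act (- g) q, n) \<in> ext S" using act_in[OF z(2)] by (simp add: ext_def)
    then have "tact beta_act g s (beta_act (- g) q, n) \<in> tact beta_act g s ` ext S" by (rule imageI)
    then show "z \<in> tact beta_act g s ` ext S" by (simp add: z(1) tact_def beta_act_minus)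
  qed
qed

lemma equidec_imp_teq:
  assumes "equidec X beta_act A B"
  shows "teq (ret A) (ret B)"
proof -
  obtain n :: nat and P g s where P: "\<forall>i<n. closedin (Ytop X) (P i) \<and> openin (Ytop X) (P i) \<and> bij (s i)"
    "A = (\<Union>i<n. P i)" "\<forall>i<n. \<forall>j<n. i \<noteq> j \<longrightarrow> P i \<inter> P j = {}"
    "B = (\<Union>i<n. tact beta_act (g i) (s i) ` P i)"
    "\<forall>i<n. \<forall>j<n. i \<noteq> j \<longrightarrow> tact beta_act (g i) (s i) ` P i \<inter> tact beta_act (g j) (s j) ` P j = {}"
    using assms unfolding equidec_def by blast
  define Q where "Q i = tact beta_act (g i) (s i) ` P i" for i
  have Qd: "Q i \<inter> Q j = {}" if "i < n" "j < n" "i \<noteq> j" for i j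
    using P(5) that by (simp add: Q_def)
  have "teq (ret (\<Union>i<k. P i)) (ret (\<Union>i<k. Q i))" if "k \<le> n" for k
    using that
  proof (induction k)
    case 0
    then show ?case by (simp add: teq_refl)
  next
    case (Suc k)
    have "teq (ret (P k)) (ret (Q k))"
      using P(1) Suc.prems by (simp add: Q_def ret_tact teq_tshift bij_is_inj)
    moreover have "(\<Union>i<k. P i) \<inter> P k = {}"
    proof -
      have "P i \<inter> P k = {}" if "i < k" for i using P(3) that Suc.prems by simp
      then show ?thesis by blast
    qed
    moreover have "(\<Union>i<k. Q i) \<inter> Q k = {}"
    proof -
      have "Q i \<inter> Q k = {}" if "i < k" for i using Qd that Suc.prems by simp
      then show ?thesis by blast
    qed
    ultimately have "teq (ret (\<Union>i<k. P i) \<union> ret (P k)) (ret (\<Union>i<k. Q i) \<union> ret (Q k))"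
      using Suc by (intro teq_Un ret_disjoint) simp_all
    then show ?case by (simp add: lessThan_Suc ret_Un Un_commute)
  qed
  from this[of n] show ?thesis by (simp add: P(2,4) Q_def)
qed

text \<open>Cut \<open>S\<close> according to displacement, source level and target level. There are
  finitely many such triples, and on each piece \<open>f\<close> is a single translation.
  \<open>ext\<close> then makes the pieces clopen and keeps them disjoint.\<close>

lemma teq_imp_equidec:
  assumes "teq S T" and NS: "\<And>x n. (x, n) \<in> S \<Longrightarrow> n < N" and NT: "\<And>x n. (x, n) \<in> T \<Longrightarrow> n < N"
  shows "equidec X beta_act (ext S) (ext T)"
proof -
  obtain f where f: "bij_betw f S T" "finite (displacement f ` S)"
    using assms(1) unfolding teq_def by blast
  define I where "I = displacement f ` S \<times> {..<N} \<times> {..<N}"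
  have "finite I" using f(2) by (simp add: I_def)
  then obtain e where "bij_betw e {0..<card I} I" using ex_bij_betw_nat_finite by blast
  then have e: "inj_on e {..<card I}" "e ` {..<card I} = I"
    by (simp_all add: bij_betw_def atLeast0LessThan)
  define n where "n = card I"
  define g where "g l = fst (e l)" for l
  \<comment> \<open>A transposition is a permutation of all levels with the prescribed effect on the
    one level that occurs in the piece.\<close>
  define s where "s l = Transposition.transpose (fst (snd (e l))) (snd (snd (e l)))" for l
  define P where "P l = {z \<in> S. (displacement f z, snd z, snd (f z)) = e l}" for l
  have "bij (s l)" for l by (simp add: s_def)
  have fP: "f z = tshift (g l) (s l) z" if "z \<in> P l" for z l
  proof -
    have "e l = (displacement f z, snd z, snd (f z))" using that by (simp add: P_def)
    then show ?thesis
      by (cases z, cases "f z") (simp add: g_def s_def displacement_def)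
  qed
  then have imP: "tshift (g l) (s l) ` P l = f ` P l" for l
    by (intro image_cong) simp_all
  have "S \<subseteq> (\<Union>l<n. P l)"
  proof
    fix z assume z: "z \<in> S"
    then have "f z \<in> T" using f(1) by (auto simp: bij_betw_def)
    then have "(displacement f z, snd z, snd (f z)) \<in> I"
      using z NS[of "fst z" "snd z"] NT[of "fst (f z)" "snd (f z)"] by (simp add: I_def)
    then obtain l where "l < n" "e l = (displacement f z, snd z, snd (f z))"
      using e(2) unfolding n_def by (metis imageE lessThan_iff)
    then show "z \<in> (\<Union>l<n. P l)" using z by (intro UN_I[of l]) (auto simp: P_def)
  qed
  then have S: "S = (\<Union>l<n. P l)" by (auto simp: P_def)
  have T: "T = (\<Union>l<n. f ` P l)"
    using f(1) S by (metis bij_betw_imp_surj_on image_UN)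
  have Pd: "P i \<inter> P j = {}" if "i < n" "j < n" "i \<noteq> j" for i j
    using e(1) that by (auto simp: P_def n_def inj_on_def)
  have fPd: "f ` P i \<inter> f ` P j = {}" if "i < n" "j < n" "i \<noteq> j" for i j
  proof -
    have "f ` P i \<inter> f ` P j = f ` (P i \<inter> P j)"
      using f(1) by (intro inj_on_image_Int[symmetric, of f S]) (auto simp: bij_betw_def P_def)
    then show ?thesis by (simp add: Pd that)
  qed
  have tP: "tact beta_act (g l) (s l) ` ext (P l) = ext (f ` P l)" for l
    using tact_ext[OF \<open>bij (s l)\<close>] imP by simp
  have "closedin (Ytop X) (ext (P l)) \<and> openin (Ytop X) (ext (P l))" for l
  proof -
    have "bounded_clopen X (ext (P l))" by (rule bounded_clopen_ext[of _ N]) (auto simp: P_def NS)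
    then show ?thesis by (simp add: bounded_clopen_def)
  qed
  moreover have "ext S = (\<Union>l<n. ext (P l))" using S ext_UN by metis
  moreover have "ext T = (\<Union>l<n. ext (f ` P l))" using T ext_UN by metis
  ultimately show ?thesis
    unfolding equidec_def
    using bounded_clopen_ext[of S N] bounded_clopen_ext[of T N] NS NT \<open>\<And>l. bij (s l)\<close>
    by (intro conjI exI[of _ n] exI[of _ "\<lambda>l. ext (P l)"] exI[of _ g] exI[of _ s])
      (simp_all add: tP ext_disjoint Pd fPd)
qed

lemma equidec_iff:
  "equidec X beta_act A B \<longleftrightarrow> bounded_clopen X A \<and> bounded_clopen X B \<and> teq (ret A) (ret B)"
proof safe
  assume AB: "bounded_clopen X A" "bounded_clopen X B" "teq (ret A) (ret B)"
  obtain N where N: "\<And>x n. (x, n) \<in> A \<union> B \<Longrightarrow> n < N"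
    using bounded_clopen_Un[OF AB(1,2)] by (rule bounded_clopen_bound) blast
  have "equidec X beta_act (ext (ret A)) (ext (ret B))"
    using AB(3) by (rule teq_imp_equidec[of _ _ N]) (auto simp: ret_def intro: N)
  then show "equidec X beta_act A B" using AB by (simp add: ext_ret)
qed (auto simp: equidec_def equidec_imp_teq)

section \<open>Sum, order and multiples in the type semigroup\<close>

lemma tclass_eq_iff:
  assumes "bounded_clopen X A" "bounded_clopen X B"
  shows "tclass X beta_act A = tclass X beta_act B \<longleftrightarrow> teq (ret A) (ret B)"
proof
  assume eq: "tclass X beta_act A = tclass X beta_act B"
  have "B \<in> tclass X beta_act B" using assms by (simp add: tclass_def equidec_iff teq_refl)
  then have "B \<in> tclass X beta_act A" unfolding eq .
  then show "teq (ret A) (ret B)" by (simp add: tclass_def equidec_iff)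
next
  assume "teq (ret A) (ret B)"
  then have "teq (ret A) (ret C) \<longleftrightarrow> teq (ret B) (ret C)" for C
    using teq_sym teq_trans by blast
  then show "tclass X beta_act A = tclass X beta_act B"
    using assms by (simp add: tclass_def equidec_iff)
qed

lemma disjoint_representative:
  assumes "bounded_clopen X A" "bounded_clopen X D"
  obtains D' where "equidec X beta_act D D'" "A \<inter> D' = {}"
proof -
  obtain N where N: "\<And>x n. (x, n) \<in> A \<union> D \<Longrightarrow> n < N"
    using bounded_clopen_Un[OF assms] by (rule bounded_clopen_bound) blast
  \<comment> \<open>The levels of \<open>D\<close> are moved above all those of \<open>A\<close>;
    \<open>N + N\<close> then bounds the levels before and after the move.\<close>
  define S where "S = tshift 0 (\<lambda>n. n + N) ` ret D"
  have "teq (ret D) S" unfolding S_def by (rule teq_tshift) (simp add: inj_def)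
  moreover have "n < N + N" if "(x, n) \<in> ret D" for x n
    using that N[of _ n] by (fastforce simp: ret_def)
  moreover have "n < N + N" if "(x, n) \<in> S" for x n
    using that N by (fastforce simp: S_def ret_def)
  ultimately have "equidec X beta_act (ext (ret D)) (ext S)" by (rule teq_imp_equidec)
  moreover have "A \<inter> ext S = {}"
  proof -
    have "N \<le> n" if "(q, n) \<in> ext S" for q n
      using ext_level[OF that] by (auto simp: S_def)
    then show ?thesis using N by fastforce
  qed
  ultimately show thesis using that assms(2) by (simp add: ext_ret)
qed

text \<open>The choice in \<open>tadd\<close> is harmless: any two disjoint pairs of representatives
  have equidecomposable unions.\<close>

lemma tadd_tclass:
  assumes "equidec X beta_act A A'" "equidec X beta_act D D'" "A' \<inter> D' = {}"
  shows "tadd X beta_act (tclass X beta_act A) (tclass X beta_act D) = tclass X beta_act (A' \<union> D')"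
proof -
  let ?P = "\<lambda>c. \<exists>A1 D1. A1 \<in> tclass X beta_act A \<and> D1 \<in> tclass X beta_act D \<and> A1 \<inter> D1 = {} \<and>
    c = tclass X beta_act (A1 \<union> D1)"
  have "?P (tclass X beta_act (A' \<union> D'))" using assms unfolding tclass_def by blast
  then have "?P (tadd X beta_act (tclass X beta_act A) (tclass X beta_act D))"
    unfolding tadd_def by (rule someI)
  then obtain A1 D1 where A1: "equidec X beta_act A A1" "equidec X beta_act D D1" "A1 \<inter> D1 = {}"
    and eq: "tadd X beta_act (tclass X beta_act A) (tclass X beta_act D) = tclass X beta_act (A1 \<union> D1)"
    unfolding tclass_def by blast
  have "teq (ret A1) (ret A')" "teq (ret D1) (ret D')"
    using A1 assms unfolding equidec_iff by (meson teq_sym teq_trans)+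
  then have "teq (ret (A1 \<union> D1)) (ret (A' \<union> D'))"
    unfolding ret_Un using A1(3) assms(3) by (intro teq_Un ret_disjoint)
  then have "tclass X beta_act (A1 \<union> D1) = tclass X beta_act (A' \<union> D')"
    using A1 assms by (subst tclass_eq_iff) (auto simp: equidec_iff intro: bounded_clopen_Un)
  then show ?thesis by (simp add: eq)
qed

text \<open>In the direction from \<open>tinj\<close>, the image \<open>T\<close> is an arbitrary
  subset of \<open>ret B\<close>; nevertheless \<open>ext (ret B - T)\<close> is clopen and serves
  as the missing summand.\<close>

lemma tle_iff:
  assumes A: "bounded_clopen X A" and B: "bounded_clopen X B"
  shows "tle X beta_act (tclass X beta_act A) (tclass X beta_act B) \<longleftrightarrow> tinj (ret A) (ret B)"
proof
  assume "tle X beta_act (tclass X beta_act A) (tclass X beta_act B)"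
  then obtain C where C: "bounded_clopen X C"
    "tclass X beta_act B = tadd X beta_act (tclass X beta_act A) (tclass X beta_act C)"
    unfolding tle_def type_semigroup_def by blast
  obtain C' where C': "equidec X beta_act C C'" "A \<inter> C' = {}"
    using disjoint_representative[OF A C(1)] .
  have "tclass X beta_act B = tclass X beta_act (A \<union> C')"
    unfolding C(2) using C' A by (intro tadd_tclass) (simp_all add: equidec_iff teq_refl)
  then have "teq (ret B) (ret (A \<union> C'))"
    using A B C' by (subst (asm) tclass_eq_iff) (auto simp: equidec_iff intro: bounded_clopen_Un)
  then have "tinj (ret (A \<union> C')) (ret B)" by (rule teq_imp_tinj[OF teq_sym])
  moreover have "tinj (ret A) (ret (A \<union> C'))"
    unfolding tinj_iff_teq ret_Un by (intro exI[of _ "ret A"] conjI teq_refl) simp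
  ultimately show "tinj (ret A) (ret B)" by (metis tinj_trans)
next
  assume "tinj (ret A) (ret B)"
  then obtain T where T: "T \<subseteq> ret B" "teq (ret A) T" unfolding tinj_iff_teq by blast
  obtain N where N: "\<And>x n. (x, n) \<in> A \<union> B \<Longrightarrow> n < N"
    using bounded_clopen_Un[OF A B] by (rule bounded_clopen_bound) blast
  have NA: "\<And>x n. (x, n) \<in> ret A \<Longrightarrow> n < N" and NB: "\<And>x n. (x, n) \<in> ret B \<Longrightarrow> n < N"
    using N by (auto simp: ret_def)
  have "equidec X beta_act (ext (ret A)) (ext T)"
    using T(2) NA by (rule teq_imp_equidec) (use T(1) NB in blast)+
  then have AT: "equidec X beta_act A (ext T)" using A by (simp add: ext_ret)
  let ?C = "ext (ret B - T)"
  have C: "bounded_clopen X ?C" by (rule bounded_clopen_ext[of _ N]) (use NB in blast)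
  have "ext T \<union> ?C = ext (T \<union> (ret B - T))" by (simp only: ext_Un)
  also have "T \<union> (ret B - T) = ret B" using T(1) by blast
  finally have "ext T \<union> ?C = B" using B by (simp add: ext_ret)
  moreover have "tadd X beta_act (tclass X beta_act A) (tclass X beta_act ?C) = tclass X beta_act (ext T \<union> ?C)"
    using AT C by (intro tadd_tclass ext_disjoint) (auto simp: equidec_iff teq_refl)
  ultimately show "tle X beta_act (tclass X beta_act A) (tclass X beta_act B)"
    unfolding tle_def type_semigroup_def using C by (intro bexI[of _ "tclass X beta_act ?C"]) auto
qed

text \<open>The representative of the multiple is found level by level, whereas
  \<open>copies\<close> gives a symmetric model of it, suited to counting.\<close>

lemma tmul_tclass:
  assumes A: "bounded_clopen X A"
  obtains D where "bounded_clopen X D" "tmul X beta_act n (tclass X beta_act A) = tclass X beta_act D"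
    "teq (ret D) (copies n (ret A))"
proof -
  have "\<exists>D. bounded_clopen X D \<and> tmul X beta_act n (tclass X beta_act A) = tclass X beta_act D \<and>
    teq (ret D) (copies n (ret A))"
  proof (induction n)
    case 0
    have "teq (ret {}) (copies 0 (ret A))" 
      by (simp add: ret_def copies_def teq_def bij_betw_def)
    then show ?case using bounded_clopen_empty by (auto simp: tzero_def)
  next
    case (Suc n)
    then obtain D where D: "bounded_clopen X D"
      "tmul X beta_act n (tclass X beta_act A) = tclass X beta_act D" "teq (ret D) (copies n (ret A))"
      by blast
    obtain D' where D': "equidec X beta_act D D'" "A \<inter> D' = {}"
      using disjoint_representative[OF A D(1)] .
    have "tmul X beta_act (Suc n) (tclass X beta_act A) = tclass X beta_act (A \<union> D')"
      using D(2) tadd_tclass[OF _ D', of A] A by (simp add: equidec_iff teq_refl)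
    moreover have "teq (ret D') (copies n (ret A))"
      using D' D(3) unfolding equidec_iff by (meson teq_sym teq_trans)
    then have "teq (ret (A \<union> D')) (copies (Suc n) (ret A))"
      unfolding ret_Un using D'(2) by (intro teq_copies_Suc ret_disjoint teq_refl)
    moreover have "bounded_clopen X (A \<union> D')"
      using A D' by (auto simp: equidec_iff intro: bounded_clopen_Un)
    ultimately show ?case by blast
  qed
  then show thesis using that by blast
qed

lemma type_semigroup_cases:
  assumes "a \<in> type_semigroup X beta_act"
  obtains A where "bounded_clopen X A" "a = tclass X beta_act A"
  using assms unfolding type_semigroup_def by blast

lemma unperforated: "unperforated X beta_act"
  unfolding unperforated_def
proof (intro ballI allI impI)
  fix a b and n :: nat
  assume "a \<in> type_semigroup X beta_act" "b \<in> type_semigroup X beta_act" "1 \<le> n"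
    and le: "tle X beta_act (tmul X beta_act n a) (tmul X beta_act n b)"
  obtain A where A: "bounded_clopen X A" "a = tclass X beta_act A"
    using \<open>a \<in> _\<close> by (rule type_semigroup_cases)
  obtain B where B: "bounded_clopen X B" "b = tclass X beta_act B"
    using \<open>b \<in> _\<close> by (rule type_semigroup_cases)
  obtain nA where nA: "bounded_clopen X nA" "tmul X beta_act n a = tclass X beta_act nA"
    "teq (ret nA) (copies n (ret A))" unfolding A(2) using tmul_tclass[OF A(1)] .
  obtain nB where nB: "bounded_clopen X nB" "tmul X beta_act n b = tclass X beta_act nB"
    "teq (ret nB) (copies n (ret B))" unfolding B(2) using tmul_tclass[OF B(1)] .
  have "tinj (ret nA) (ret nB)" using le nA nB by (simp add: tle_iff)
  then have "tinj (copies n (ret A)) (ret nB)"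
    using teq_imp_tinj[OF teq_sym[OF nA(3)]] tinj_trans by blast
  then have "tinj (copies n (ret A)) (copies n (ret B))"
    using teq_imp_tinj[OF nB(3)] tinj_trans by blast
  then have "tinj (ret A) (ret B)"
    using \<open>1 \<le> n\<close> finite_ret_fibre[OF B(1)] by (rule tinj_copies_cancel)
  then show "tle X beta_act a b" using A B by (simp add: tle_iff)
qed

lemma partial_order: "partial_order_on (type_semigroup X beta_act) (tle_rel X beta_act)"
proof -
  have "refl_on (type_semigroup X beta_act) (tle_rel X beta_act)"
  proof (rule refl_onI)
    fix a assume a: "a \<in> type_semigroup X beta_act"
    then obtain A where "bounded_clopen X A" "a = tclass X beta_act A" by (rule type_semigroup_cases)
    with a show "(a, a) \<in> tle_rel X beta_act"
      by (simp add: tle_rel_def tle_iff teq_imp_tinj teq_refl)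
  qed
  moreover have "trans (tle_rel X beta_act)"
  proof (rule transI)
    fix a b c assume ab: "(a, b) \<in> tle_rel X beta_act" and bc: "(b, c) \<in> tle_rel X beta_act"
    obtain A where A: "bounded_clopen X A" "a = tclass X beta_act A"
      using ab unfolding tle_rel_def by (auto elim: type_semigroup_cases)
    obtain B where B: "bounded_clopen X B" "b = tclass X beta_act B"
      using ab unfolding tle_rel_def by (auto elim: type_semigroup_cases)
    obtain C where C: "bounded_clopen X C" "c = tclass X beta_act C"
      using bc unfolding tle_rel_def by (auto elim: type_semigroup_cases)
    have "tinj (ret A) (ret B)" "tinj (ret B) (ret C)"
      using ab bc A B C by (simp_all add: tle_rel_def tle_iff)
    then have "tinj (ret A) (ret C)" by (rule tinj_trans)
    then show "(a, c) \<in> tle_rel X beta_act" using ab bc A C by (simp add: tle_rel_def tle_iff)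
  qed
  moreover have "antisym (tle_rel X beta_act)"
  proof (rule antisymI)
    fix a b assume ab: "(a, b) \<in> tle_rel X beta_act" "(b, a) \<in> tle_rel X beta_act"
    obtain A where A: "bounded_clopen X A" "a = tclass X beta_act A"
      using ab unfolding tle_rel_def by (auto elim: type_semigroup_cases)
    obtain B where B: "bounded_clopen X B" "b = tclass X beta_act B"
      using ab unfolding tle_rel_def by (auto elim: type_semigroup_cases)
    have "tinj (ret A) (ret B)" "tinj (ret B) (ret A)"
      using ab A B by (simp_all add: tle_rel_def tle_iff)
    then have "teq (ret A) (ret B)" by (rule tinj_antisym)
    then show "a = b" using A B by (simp add: tclass_eq_iff)
  qed
  moreover have "tle_rel X beta_act \<subseteq> type_semigroup X beta_act \<times> type_semigroup X beta_act"
    by (auto simp: tle_rel_def)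
  ultimately show ?thesis by (simp add: partial_order_on_def preorder_on_def)
qed

section \<open>Dynamical comparison\<close>

lemma continuous_map_act: "continuous_map X X (beta_act g)"
  using continuous_map_from_subtopology[OF continuous_map_beta_act] act_in
  by (auto simp: continuous_map_in_subtopology image_subset_iff)

text \<open>By minimality the translates of \<open>B\<close> cover \<open>M\<close>, and by
  compactness finitely many do; read this along the orbit of \<open>p\<close>.\<close>

lemma syndetic:
  assumes B: "openin X B" "B \<noteq> {}"
  obtains L where "finite L" "\<And>x. \<exists>l\<in>L. l + x \<in> hits B"
proof -
  have BM: "B \<subseteq> M" using openin_subset[OF B(1)] topspace_X by simp
  define V where "V g = {q \<in> topspace X. beta_act g q \<in> B}" for g
  have openV: "openin X (V g)" for g
    unfolding V_def using continuous_map_act B(1) by (rule openin_continuous_map_preimage)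
  \<comment> \<open>The points whose orbit avoids \<open>B\<close> form a closed invariant set. If
    nonempty, it would be all of \<open>M\<close> and contain the points of
    \<open>B\<close>.\<close>
  let ?N = "M - (\<Union>g. V g)"
  have "M \<subseteq> (\<Union>g. V g)"
  proof (rule ccontr)
    assume "\<not> M \<subseteq> (\<Union>g. V g)"
    moreover have "closedin X (topspace X - (\<Union>g. V g))"
      by (intro closedin_diff closedin_topspace openin_Union) (auto simp: openV)
    then have "closedin beta_top ?N"
      using closed_M closedin_trans_full unfolding topspace_X by blast
    moreover have "beta_act h q \<in> ?N" if q: "q \<in> ?N" for h q
    proof -
      have "beta_act h q \<notin> V g" for g
      proof
        assume "beta_act h q \<in> V g"
        then have "q \<in> V (g + h)" using q unfolding V_def topspace_X beta_act_add by blast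
        with q show False by blast
      qed
      then show ?thesis using q act_in by blast
    qed
    ultimately have "?N = M"
      using minimal unfolding minimal_subflow_def by (metis Diff_subset Diff_eq_empty_iff image_subsetI)
    moreover obtain b where "b \<in> B" using B(2) by blast
    then have "b \<in> M" "b \<in> V 0" using BM by (auto simp: V_def topspace_X beta_act_zero)
    ultimately show False by blast
  qed
  moreover have "compactin X M"
    using compact_space_X topspace_X by (simp add: compact_space_def)
  moreover have "\<forall>U\<in>range V. openin X U" using openV by blast
  ultimately obtain \<F> where F: "finite \<F>" "\<F> \<subseteq> range V" "M \<subseteq> \<Union>\<F>"
    unfolding compactin_def by meson
  then obtain L where L: "finite L" "\<F> = V ` L" by (meson finite_subset_image)
  have "\<exists>l\<in>L. l + x \<in> hits B" for x
  proof -
    have "beta_act x p \<in> \<Union>\<F>" using act_in[OF p_in] F(3) by blast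
    then obtain l where "l \<in> L" "beta_act x p \<in> V l" unfolding L(2) by blast
    then show ?thesis by (auto simp: V_def hits_def beta_act_add)
  qed
  then show thesis using that L(1) by blast
qed

text \<open>Composing the mean with \<open>hits\<close> gives a content on clopen sets:
  \<open>hits\<close> preserves disjoint unions and turns preimages under the action into preimages
  under left translation.\<close>

lemma invariant_measure_from_mean:
  assumes nonneg: "\<And>S. 0 \<le> m S" and total: "m UNIV = 1"
    and additive: "\<And>S T. S \<inter> T = {} \<Longrightarrow> m (S \<union> T) = m S + m T"
    and inv: "\<And>g S. m ((\<lambda>x. g + x) -` S) = m S"
  obtains R where "radon_prob X R" "invariant_measure X beta_act R"
    "\<And>C. clopenin X C \<Longrightarrow> measure R C = m (hits C)"
proof -
  interpret content: clopen_content X "\<lambda>C. m (hits C)"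
  proof
    show "compact_space X" by (rule compact_space_X)
    show "\<exists>C. clopenin X C \<and> q \<in> C \<and> C \<subseteq> U" if "openin X U" "q \<in> U" for U q
      using openin_X_limits[OF that] clopenin_limits by metis
    show "0 \<le> m (hits C)" for C by (rule nonneg)
    show "m (hits (C \<union> D)) = m (hits C) + m (hits D)" if "C \<inter> D = {}" for C D
    proof -
      have "hits (C \<union> D) = hits C \<union> hits D" "hits C \<inter> hits D = {}"
        using that by (auto simp: hits_def)
      then show ?thesis using additive by simp
    qed
    have "hits (topspace X) = UNIV" using act_in[OF p_in] by (auto simp: hits_def topspace_X)
    then show "m (hits (topspace X)) = 1" by (simp add: total)
  qed
  have act_inv: "m (hits (beta_act g -` C \<inter> topspace X)) = m (hits C)" for g C
  proof -
    have "hits (beta_act g -` C \<inter> topspace X) = (\<lambda>x. g + x) -` hits C"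
      using act_in[OF p_in] by (auto simp: hits_def topspace_X beta_act_add)
    then show ?thesis by (simp add: inv)
  qed
  have "measure content.radon (beta_act g -` B \<inter> topspace X) = measure content.radon B"
    if "B \<in> borel_sets_of X" for g B
    by (rule content.measure_radon_vimage[of _ "beta_act (- g)"])
      (simp_all add: continuous_map_act beta_act_minus act_inv that del: topspace_subtopology)
  then have "invariant_measure X beta_act content.radon"
    by (simp add: invariant_measure_def content.sets_radon del: topspace_subtopology)
  then show thesis
    using that content.radon_prob_radon content.measure_radon_clopen by blast
qed

lemma comparison: "dynamical_comparison X beta_act"
  unfolding dynamical_comparison_def
proof (intro allI impI, elim conjE)
  fix A B
  assume "closedin X A" "openin X A" "closedin X B" "openin X B" "B \<noteq> {}"
    and less: "\<forall>R. radon_prob X R \<and> invariant_measure X beta_act R \<longrightarrow> measure R A < measure R B"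
  then have A: "clopenin X A" and B: "clopenin X B" by (simp_all add: clopenin_def)
  have ret: "ret (C \<times> {0}) = hits C \<times> {0}" for C by (auto simp: ret_def hits_def)
  have "tinj (hits A \<times> {0::nat}) (hits B \<times> {0::nat})"
  proof (rule ccontr)
    assume ninj: "\<not> tinj (hits A \<times> {0::nat}) (hits B \<times> {0::nat})"
    obtain L where L: "finite L" "\<And>x. \<exists>l\<in>L. l + x \<in> hits B"
      by (rule syndetic[OF \<open>openin X B\<close> \<open>B \<noteq> {}\<close>]) blast
    obtain m :: "'g set \<Rightarrow> real" where m: "\<And>S. 0 \<le> m S" "m UNIV = 1"
      "\<And>S T. S \<inter> T = {} \<Longrightarrow> m (S \<union> T) = m S + m T" "\<And>g S. m ((\<lambda>x. g + x) -` S) = m S"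
      and le: "m (hits B) \<le> m (hits A)"
      using invariant_mean[OF ninj L] by blast
    obtain R where "radon_prob X R" "invariant_measure X beta_act R"
      and R: "\<And>C. clopenin X C \<Longrightarrow> measure R C = m (hits C)"
      using invariant_measure_from_mean[of m, OF m] by blast
    then have "measure R A < measure R B" using less by blast
    then show False using le R[OF A] R[OF B] by simp
  qed
  then show "tle X beta_act (tclass X beta_act (A \<times> {0})) (tclass X beta_act (B \<times> {0}))"
    using A B by (simp add: tle_iff bounded_clopen_level ret)
qed

end

theorem theoremt:
  fixes M :: "('g::{group_add, countable}) set set set"
  assumes "minimal_subflow M"
  shows "unperforated (subtopology beta_top M) (beta_act :: 'g \<Rightarrow> _)
       \<and> partial_order_on (type_semigroup (subtopology beta_top M) (beta_act :: 'g \<Rightarrow> _))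
           (tle_rel (subtopology beta_top M) (beta_act :: 'g \<Rightarrow> _))
       \<and> dynamical_comparison (subtopology beta_top M) (beta_act :: 'g \<Rightarrow> _)"
proof -
  obtain p where "p \<in> M" "\<And>q. q \<in> M \<Longrightarrow> umult q p = q"
    by (rule minimal_subflow_right_identity[OF assms]) blast
  then interpret minimal_flow M p
    using assms by unfold_locales
  show ?thesis by (intro conjI unperforated partial_order comparison)
qed

end
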